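(* Let $\theta=(a_1,a_2,a_3,a_4,a_5,a_6;1,1,d_1,d_2;3)$ with $\deg(\theta)=-1$ and such that $-d_j-\sum_{i\in I}a_i\notin\mathbb{Z}$ for every $I\subset\{1,\dots,6\}$ and $j=1,2$; $a_i-a_j\notin\mathbb{Z}$ for $i\neq j$; and $d_1\neq d_2$. Let $\theta'=(a_1-1,a_2-1,a_3,a_4,a_5,a_6;1,1,d_1+1,d_2+1;3)$, let $dPVI:M_\theta\to M_{\theta'}$ be the isomorphism given by modification of d-connections, let $q,p$ denote the coordinate functions on $M_\theta$ and on $M_{\theta'}$, and set $p':=p\circ dPVI$, $q':=q\circ dPVI:M_\theta\to\mathbb{P}^1$. For $j=1,2$ set $$c_j:=\dfrac{(d_j+a_1+a_2+a_4-1)(d_j+a_1+a_2+a_5-1)(d_j+a_1+a_2+a_6-1)}{d_j-d_{3-j}}.$$ Then (as identities between rational functions on $M_\theta$) $$\begin{cases} q'=(p-1)(q+1-a_1-a_2)+pa_3+\displaystyle\sum_{j=1,2}\dfrac{c_jp}{\left(q-\frac{p(1-a_1-a_2-d_j)-a_3}{p-1}\right)},\\[4mm] p'\cdot p=\dfrac{(q'-a_1+1)(q'-a_2+1)}{(q'-a_4)(q'-a_5)(q'-a_6)}\cdot\big((p-1)(q'-q)+q'-a_3\big). \end{cases}$$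
   Context: The ground field is $\mathbb{C}$; $z$ is the coordinate on $\mathbb{P}^1$. A d-connection on a vector bundle $L$ on $\mathbb{P}^1$ is a linear operator $A(z):L_z\to L_{z+1}$ between fibers depending rationally on $z\in\mathbb{C}$ (a rational map between $L$ and $s^*L$, $s(z)=z+1$). Isomorphisms of pairs $(L,A)$ are bundle isomorphisms compatible with the d-connections. A d-connection $A$ on a rank $2$ bundle $L$ is of type $\theta=(a_1,\dots,a_k;\rho_1,\rho_2,d_1,d_2;n)$ if: (1) the only zeroes and poles of $A(z)$ are a pole of order $n$ at infinity and simple zeroes at the $k$ distinct points $a_1,\dots,a_k\in\mathbb{C}$ (a point $a_i$ is a simple zero if $A(z)$ is regular at $a_i$ and $\det A(z)$ has a zero of order $1$ there); (2) on the formal neighborhood of $\infty\in\mathbb{P}^1$ there is a trivialization $R(z):\mathbb{C}^2\to L_z$ (essentially an invertible matrix-valued Taylor series in $z^{-1}$) with $$R(z+1)^{-1}A(z)R(z)=\begin{bmatrix}\rho_1(z^n+d_1z^{n-1})&0\\ 0&\rho_2(z^n+d_2z^{n-1})\end{bmatrix}.$$ $M_\theta$ denotes the coarse moduli space of d-connections of type $\theta$. $\deg(\theta):=-d_1-d_2-\sum_i a_i$. The isomorphism $dPVI$: for $(L,A)\in M_\theta$, the image $dPVI(L,A)=(L',A')$ is the only d-connection of type $\theta'$ (up to isomorphism) that admits a rational isomorphism $R:L'\dashrightarrow L$ with $R(z+1)A'(z)=A(z)R(z)$. The coordinates $(q,p)$: $\mathcal{O}(k)$ is the line bundle whose sections are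 functions on $\mathbb{P}^1$ with pole of order at most $k$ at $\infty$. For $(L,A)\in M_\theta$ the bundle $L$ is isomorphic to $\mathcal{O}\oplus\mathcal{O}(-1)$; choosing an isomorphism $S:\mathcal{O}\oplus\mathcal{O}(-1)\to L$, the d-connection has matrix $S(z+1)^{-1}A(z)S(z)=\begin{bmatrix}a_{11}&a_{12}\\ a_{21}&a_{22}\end{bmatrix}$ with polynomial entries, $\deg a_{11},\deg a_{22},\deg a_{12}\le3$, $\deg a_{21}\le1$. Then $q\in\mathbb{P}^1$ is the unique zero of $a_{21}\not\equiv0$ viewed as a section of $\mathcal{O}(1)$, and $p=a_{11}(q)/\big((q-a_4)(q-a_5)(q-a_6)\big)$, where numerator and denominator are the values at $q$ of the sections $a_{11}$ and $(z-a_4)(z-a_5)(z-a_6)$ of $\mathcal{O}(3)$. These do not depend on $S$ and define regular maps $q,p:M_\theta\to\mathbb{P}^1$ (where the ratio is indeterminate, $p$ is defined by extension), with $(q,p):M_\theta\to(\mathbb{P}^1)^2$ birational. On $M_{\theta'}$ they are defined in the same way using the parameters of $\theta'$.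
   Formalization: The image under dPVI is assumed to be the only d-connection of type θ' rationally isomorphic to (L,A); this uniqueness fails when d_1-d_2 is a nonzero integer, so nothing is claimed for those parameters. *)

theory Defs
  imports "HOL-Analysis.Analysis" "HOL-Computational_Algebra.Computational_Algebra"
    "HOL-Computational_Algebra.Field_as_Ring"
begin

section \<open>The projective line and rational functions\<close>

datatype P1 = Fin complex | Infty

type_synonym ratfun = "complex poly fract"

primrec P1_shift :: "P1 \<Rightarrow> P1" where
  "P1_shift (Fin x) = Fin (x + 1)"
| "P1_shift Infty = Infty"

text \<open>\<open>shift f\<close> is the rational function \<open>f(z + 1)\<close>.\<close>

definition shift :: "ratfun \<Rightarrow> ratfun" where
  "shift h = (case quot_of_fract h of (f, g) \<Rightarrow>
                Fraction_Field.Fract (pcompose f [:1, 1:]) (pcompose g [:1, 1:]))"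

lemma Fract_quot_of_fract:
  obtains f g where "quot_of_fract h = (f, g)" "g \<noteq> 0" "h = Fraction_Field.Fract f g"
  by (metis case_prod_conv prod.collapse quot_to_fract_def quot_to_fract_quot_of_fract
            snd_quot_of_fract_nonzero)

lemma shift_Fract:
  assumes "g \<noteq> 0"
  shows "shift (Fraction_Field.Fract f g) =
         Fraction_Field.Fract (pcompose f [:1, 1:]) (pcompose g [:1, 1:])"
proof -
  have nz: "pcompose k [:1, 1:] \<noteq> 0" if "k \<noteq> 0" for k :: "complex poly"
    using that by (simp add: pcompose_eq_0_iff)
  obtain f' g' where q: "quot_of_fract (Fraction_Field.Fract f g) = (f', g')" "g' \<noteq> 0"
      "Fraction_Field.Fract f g = Fraction_Field.Fract f' g'"
    by (rule Fract_quot_of_fract)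
  from q(3) have "f * g' = f' * g"
    using assms q(2) by (simp add: eq_fract)
  then have "pcompose f [:1, 1:] * pcompose g' [:1, 1:] =
             pcompose f' [:1, 1:] * pcompose g [:1, 1:]"
    by (metis pcompose_mult)
  then show ?thesis using assms q(1,2) by (simp add: shift_def eq_fract nz)
qed

text \<open>\<open>at_inf f\<close> is the Laurent expansion of \<open>f\<close> at infinity; the variable of the
  Laurent series is the local parameter \<open>w = z\<^sup>-\<^sup>1\<close>, so that \<open>z\<close> becomes
  \<open>fls_X_inv\<close>.\<close>

definition poly_at_inf :: "complex poly \<Rightarrow> complex fls" where
  "poly_at_inf f = poly (map_poly fls_const f) fls_X_inv"

lemma poly_at_inf_pCons: "poly_at_inf (pCons c f) = fls_const c + fls_X_inv * poly_at_inf f"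
  by (cases "c = 0 \<and> f = 0") (auto simp: poly_at_inf_def map_poly_pCons)

lemma poly_at_inf_0 [simp]: "poly_at_inf 0 = 0"
  by (simp add: poly_at_inf_def)

lemma poly_at_inf_add: "poly_at_inf (f + g) = poly_at_inf f + poly_at_inf g"
  by (induction f g rule: poly_induct2)
     (simp_all add: poly_at_inf_pCons algebra_simps flip: fls_plus_const)

lemma poly_at_inf_smult: "poly_at_inf (smult c f) = fls_const c * poly_at_inf f"
  by (induction f) (simp_all add: poly_at_inf_pCons algebra_simps)

lemma poly_at_inf_mult: "poly_at_inf (f * g) = poly_at_inf f * poly_at_inf g"
  by (induction f)
     (simp_all add: poly_at_inf_pCons poly_at_inf_add poly_at_inf_smult algebra_simps)

lemma poly_at_inf_nonzero:
  assumes "f \<noteq> 0" shows "poly_at_inf f \<noteq> 0"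
proof -
  have "degree (map_poly fls_const f) = degree f"
    by (rule degree_map_poly) simp
  then have "fls_nth (poly_at_inf f) (- int (degree f)) =
      (\<Sum>i\<le>degree f. coeff f i * fls_nth (fls_X_inv ^ i) (- int (degree f)))"
    by (simp add: poly_at_inf_def poly_altdef coeff_map_poly fls_nth_sum)
  also have "\<dots> = (\<Sum>i\<le>degree f. if i = degree f then coeff f i else 0)"
    by (intro sum.cong) (auto simp: fls_X_inv_power_nth)
  also have "\<dots> = coeff f (degree f)" by simp
  finally show ?thesis using assms by auto
qed

definition at_inf :: "ratfun \<Rightarrow> complex fls" where
  "at_inf h = (case quot_of_fract h of (f, g) \<Rightarrow> poly_at_inf f / poly_at_inf g)"

lemma at_inf_Fract:
  assumes "g \<noteq> 0"
  shows "at_inf (Fraction_Field.Fract f g) = poly_at_inf f / poly_at_inf g"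
proof -
  obtain f' g' where q: "quot_of_fract (Fraction_Field.Fract f g) = (f', g')" "g' \<noteq> 0"
      "Fraction_Field.Fract f g = Fraction_Field.Fract f' g'"
    by (rule Fract_quot_of_fract)
  from q(3) have "f * g' = f' * g"
    using assms q(2) by (simp add: eq_fract)
  then have "poly_at_inf f * poly_at_inf g' = poly_at_inf f' * poly_at_inf g"
    by (metis poly_at_inf_mult)
  then show ?thesis
    using assms q(1,2) by (simp add: at_inf_def frac_eq_eq poly_at_inf_nonzero)
qed

primrec regular_at :: "P1 \<Rightarrow> ratfun \<Rightarrow> bool" where
  "regular_at (Fin x) h \<longleftrightarrow> (\<exists>f g. h = Fraction_Field.Fract f g \<and> poly g x \<noteq> 0)"
| "regular_at Infty h \<longleftrightarrow> (\<exists>f g. h = Fraction_Field.Fract f g \<and> g \<noteq> 0 \<and> degree f \<le> degree g)"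

text \<open>\<open>h\<close> is regular at \<open>x\<close> and vanishes there to order exactly one.\<close>

definition simple_zero :: "complex \<Rightarrow> ratfun \<Rightarrow> bool" where
  "simple_zero x h \<longleftrightarrow>
     (\<exists>f g. h = Fraction_Field.Fract f g \<and> poly g x \<noteq> 0 \<and> f \<noteq> 0 \<and> order x f = 1)"

section \<open>Two by two matrices\<close>

type_synonym 'a mat2 = "'a^2^2"

definition mat2 :: "'a \<Rightarrow> 'a \<Rightarrow> 'a \<Rightarrow> 'a \<Rightarrow> 'a mat2" where
  "mat2 a11 a12 a21 a22 =
     (\<chi> i j. if i = 1 then (if j = 1 then a11 else a12) else (if j = 1 then a21 else a22))"

definition map_mat :: "('a \<Rightarrow> 'b) \<Rightarrow> 'a mat2 \<Rightarrow> 'b mat2" where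
  "map_mat f M = (\<chi> i j. f (M $ i $ j))"

definition regular_mat_at :: "P1 \<Rightarrow> ratfun mat2 \<Rightarrow> bool" where
  "regular_mat_at x M \<longleftrightarrow> (\<forall>i j. regular_at x (M $ i $ j))"

text \<open>Membership in \<open>GL\<^sub>2\<close> of the local ring at \<open>x\<close>.\<close>

definition unit_mat_at :: "P1 \<Rightarrow> ratfun mat2 \<Rightarrow> bool" where
  "unit_mat_at x M \<longleftrightarrow>
     invertible M \<and> regular_mat_at x M \<and> regular_mat_at x (matrix_inv M)"

text \<open>For \<open>S\<close> a (rational) frame and \<open>A\<close> a rational map from the bundle to its pullback under
  the shift, \<open>gauge S A\<close> is the matrix \<open>S(z+1)\<^sup>-\<^sup>1 A(z) S(z)\<close> of \<open>A\<close> in the frame \<open>S\<close>.\<close>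

definition gauge :: "ratfun mat2 \<Rightarrow> ratfun mat2 \<Rightarrow> ratfun mat2" where
  "gauge S A = matrix_inv (map_mat shift S) ** A ** S"

section \<open>Rank two bundles and d-connections\<close>

text \<open>A rank two bundle with its generic fibre identified with \<open>\<complex>(z)\<^sup>2\<close> is the same as the
  family of its stalks, which are free rank two lattices in \<open>\<complex>(z)\<^sup>2\<close> over the local rings of
  the projective line, and which are standard at almost every point. Here the stalk at \<open>x\<close> is
  given by a frame \<open>L x\<close>, i.e. by a local trivialization near \<open>x\<close>: it is the lattice spanned by
  the columns of \<open>L x\<close>. Bundle maps are matrices over \<open>\<complex>(z)\<close>, acting on the generic
  fibres; nothing depends on the choice of the frames.\<close>

type_synonym rank2_bundle = "P1 \<Rightarrow> ratfun mat2"

definition is_bundle :: "rank2_bundle \<Rightarrow> bool" where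
  "is_bundle L \<longleftrightarrow> (\<forall>x. invertible (L x)) \<and> finite {x. \<not> unit_mat_at x (L x)}"

definition bundle_iso :: "ratfun mat2 \<Rightarrow> rank2_bundle \<Rightarrow> rank2_bundle \<Rightarrow> bool" where
  "bundle_iso S L L' \<longleftrightarrow> invertible S \<and> (\<forall>x. unit_mat_at x (matrix_inv (L' x) ** S ** L x))"

text \<open>\<open>\<O>(k) \<oplus> \<O>(l)\<close>: the sections of \<open>\<O>(k)\<close> near infinity are the functions with a pole of
  order at most \<open>k\<close>, so they are generated by \<open>z\<^sup>k\<close>.\<close>

primrec O_sum :: "int \<Rightarrow> int \<Rightarrow> rank2_bundle" where
  "O_sum k l (Fin x) = mat 1"
| "O_sum k l Infty = mat2 (to_fract [:0, 1:] powi k) 0 0 (to_fract [:0, 1:] powi l)"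

text \<open>A pair \<open>(L, A)\<close>, where \<open>A\<close> is a rational map from \<open>L\<close> to its pullback under the shift.\<close>

type_synonym dconn = "rank2_bundle \<times> ratfun mat2"

definition is_dconn :: "dconn \<Rightarrow> bool" where
  "is_dconn X \<longleftrightarrow> is_bundle (fst X) \<and> invertible (snd X)"

text \<open>The matrix of \<open>A\<close> in the local frames at \<open>x\<close> (of \<open>L\<close>) and \<open>P1_shift x\<close> (of \<open>L\<close>, pulled back).\<close>

definition local_mat :: "dconn \<Rightarrow> P1 \<Rightarrow> ratfun mat2" where
  "local_mat X x = (case X of (L, A) \<Rightarrow> matrix_inv (map_mat shift (L (P1_shift x))) ** A ** L x)"

definition dconn_iso :: "dconn \<Rightarrow> dconn \<Rightarrow> bool" where
  "dconn_iso X Y \<longleftrightarrow>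
     (\<exists>S. bundle_iso S (fst X) (fst Y) \<and> map_mat shift S ** snd X = snd Y ** S)"

text \<open>A rational isomorphism from the bundle of \<open>Y\<close> to that of \<open>X\<close>, compatible with the
  d-connections.\<close>

definition rationally_iso :: "dconn \<Rightarrow> dconn \<Rightarrow> bool" where
  "rationally_iso Y X \<longleftrightarrow>
     (\<exists>R. invertible R \<and> map_mat shift R ** snd Y = snd X ** R)"

section \<open>D-connections of a given type\<close>

record dtype =
  zeros :: "complex list"
  rho1 :: complex
  rho2 :: complex
  coef_d1 :: complex
  coef_d2 :: complex
  pole_order :: nat

definition dtype_deg :: "dtype \<Rightarrow> complex" where
  "dtype_deg \<theta> = - coef_d1 \<theta> - coef_d2 \<theta> - sum_list (zeros \<theta>)"

definition zeros_poles_of_type :: "dtype \<Rightarrow> dconn \<Rightarrow> bool" where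
  "zeros_poles_of_type \<theta> X \<longleftrightarrow> distinct (zeros \<theta>) \<and>
     (\<forall>x. x \<notin> set (zeros \<theta>) \<longrightarrow> unit_mat_at (Fin x) (local_mat X (Fin x))) \<and>
     (\<forall>x\<in>set (zeros \<theta>). regular_mat_at (Fin x) (local_mat X (Fin x)) \<and>
         simple_zero x (det (local_mat X (Fin x)))) \<and>
     (\<forall>m. regular_mat_at Infty
            (map_mat (\<lambda>h. h / to_fract [:0, 1:] ^ m) (local_mat X Infty)) \<longleftrightarrow> pole_order \<theta> \<le> m)"

text \<open>\<open>z \<mapsto> z + 1\<close> on power series in \<open>w = z\<^sup>-\<^sup>1\<close> is the substitution \<open>w \<mapsto> w / (1 + w)\<close>.\<close>

definition fps_shift_at_inf :: "complex fps \<Rightarrow> complex fps" where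
  "fps_shift_at_inf r = r oo (fps_X / (1 + fps_X))"

text \<open>The expansion at infinity of \<open>\<rho> (z\<^sup>n + d z\<^sup>n\<^sup>-\<^sup>1)\<close>.\<close>

definition normal_entry :: "complex \<Rightarrow> complex \<Rightarrow> nat \<Rightarrow> complex fls" where
  "normal_entry \<rho> d n = fls_const \<rho> * (fls_X_inv ^ n * (1 + fls_const d * fls_X))"

definition formal_type_at_inf :: "dtype \<Rightarrow> dconn \<Rightarrow> bool" where
  "formal_type_at_inf \<theta> X \<longleftrightarrow>
     (\<exists>R :: complex fps mat2. invertible R \<and>
        matrix_inv (map_mat (\<lambda>r. fps_to_fls (fps_shift_at_inf r)) R)
          ** map_mat at_inf (local_mat X Infty) ** map_mat fps_to_fls R =
        mat2 (normal_entry (rho1 \<theta>) (coef_d1 \<theta>) (pole_order \<theta>)) 0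
             0 (normal_entry (rho2 \<theta>) (coef_d2 \<theta>) (pole_order \<theta>)))"

text \<open>The points of the moduli space are the isomorphism classes of elements of \<open>moduli \<theta>\<close>.\<close>

definition moduli :: "dtype \<Rightarrow> dconn set" where
  "moduli \<theta> = {X. is_dconn X \<and> zeros_poles_of_type \<theta> X \<and> formal_type_at_inf \<theta> X}"

text \<open>\<open>Y\<close> is the only d-connection of type \<open>\<theta>'\<close>, up to isomorphism, admitting a rational
  isomorphism to \<open>X\<close>; i.e. the class of \<open>Y\<close> is the image of the class of \<open>X\<close>.\<close>

definition is_dPVI :: "dtype \<Rightarrow> dconn \<Rightarrow> dconn \<Rightarrow> bool" where
  "is_dPVI \<theta>' X Y \<longleftrightarrow> Y \<in> moduli \<theta>' \<and> rationally_iso Y X \<and>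
     (\<forall>Y'\<in>moduli \<theta>'. rationally_iso Y' X \<longrightarrow> dconn_iso Y' Y)"

section \<open>The coordinates\<close>

text \<open>The value of a section \<open>f\<close> of \<open>\<O>(k)\<close>, i.e. of a polynomial of degree at most \<open>k\<close>, at a
  point; at infinity the fibre is trivialized by \<open>z\<^sup>k\<close>.\<close>

primrec section_value :: "nat \<Rightarrow> complex poly \<Rightarrow> P1 \<Rightarrow> complex" where
  "section_value k f (Fin x) = poly f x"
| "section_value k f Infty = coeff f k"

text \<open>The point \<open>u / v\<close> of the projective line, for \<open>(u, v) \<noteq> (0, 0)\<close>.\<close>

definition ratio :: "complex \<Rightarrow> complex \<Rightarrow> P1" where
  "ratio u v = (if v = 0 then Infty else Fin (u / v))"

text \<open>The extension of \<open>p\<close> to the points where \<open>a\<^sub>1\<^sub>1(q) / ((q-a\<^sub>4)(q-a\<^sub>5)(q-a\<^sub>6))\<close> is \<open>0 / 0\<close>: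
  for \<open>\<rho>\<^sub>1 = \<rho>\<^sub>2 = 1\<close> one has \<open>a\<^sub>1\<^sub>1(q) a\<^sub>2\<^sub>2(q) = (q-a\<^sub>1) \<cdots> (q-a\<^sub>6)\<close> because \<open>a\<^sub>2\<^sub>1(q) = 0\<close>, hence
  the quotient equals \<open>(q-a\<^sub>1)(q-a\<^sub>2)(q-a\<^sub>3) / a\<^sub>2\<^sub>2(q)\<close>, which is not \<open>0 / 0\<close> at these points since
  there \<open>q\<close> is one of \<open>a\<^sub>4, a\<^sub>5, a\<^sub>6\<close>.
  Indices into the list of zeros start at \<open>0\<close>.\<close>

definition p_value :: "dtype \<Rightarrow> complex poly \<Rightarrow> complex poly \<Rightarrow> P1 \<Rightarrow> P1" where
  "p_value \<theta> a11 a22 q =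
     (let a = (\<lambda>i. [: - (zeros \<theta> ! (i - 1)), 1 :]);
          u = section_value 3 a11 q;
          v = section_value 3 (a 4 * a 5 * a 6) q
      in if u = 0 \<and> v = 0
         then ratio (section_value 3 (a 1 * a 2 * a 3) q) (section_value 3 a22 q)
         else ratio u v)"

text \<open>\<open>X\<close>, a d-connection of type \<open>\<theta>\<close>, has the coordinates \<open>q\<close> and \<open>p\<close>.\<close>

definition has_coordinates :: "dtype \<Rightarrow> dconn \<Rightarrow> P1 \<Rightarrow> P1 \<Rightarrow> bool" where
  "has_coordinates \<theta> X q p \<longleftrightarrow>
     (\<exists>S a11 a12 a21 a22.
        bundle_iso S (O_sum 0 (-1)) (fst X) \<and>
        gauge S (snd X) = map_mat to_fract (mat2 a11 a12 a21 a22) \<and>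
        degree a11 \<le> 3 \<and> degree a12 \<le> 3 \<and> degree a21 \<le> 1 \<and> degree a22 \<le> 3 \<and>
        a21 \<noteq> 0 \<and> section_value 1 a21 q = 0 \<and>
        p = p_value \<theta> a11 a22 q)"

end

(* The image of (L, A) under dPVI is the elementary modification of L: the stalks at a_1 and a_2
   are enlarged so that the zeros of A there move to a_1 - 1 and a_2 - 1, the stalk at infinity is
   multiplied by z^-1, and A is unchanged. The uniqueness in the definition of dPVI makes it
   enough to compute with this bundle. In frames of O + O(-1), the modification is a polynomial
   matrix R with R(z+1) A(z) = B(z) R(z), with det R = const * (z - a_1)(z - a_2) and with constant
   lower left entry r.

   If r is nonzero, automorphisms of O + O(-1) on both sides bring R to an antidiagonal form. Then
   a_22 = (z - a_1)(z - a_2)(z - t), a_12 = beta (z - a_1)(z - a_2)(z - q'),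
   b_11 = (z + 1 - a_1)(z + 1 - a_2)(z - t), and the formal type at infinity gives
   beta * gamma = -(t - t_1)(t - t_2), where gamma is the leading coefficient of a_21 and
   t_j = 1 - a_1 - a_2 - d_j. Evaluating det A at q and at t gives p (q - t) = q - a_3 and
   q' = t + (p - 1)(t - a_4)(t - a_5)(t - a_6) / ((t - t_1)(t - t_2)); the partial fractions of
   the latter are the first formula. If r = 0, then R is diagonal up to such automorphisms,
   p = 0, and {q, q' + 1} = {a_1, a_2}. *)

theory Submission
  imports Defs
begin

\<comment> \<open>With both meanings of \<open>$\<close> active, matrix terms take exponential time to parse.\<close>
no_notation fps_nth (infixl "$" 75)

section \<open>Two by two matrices\<close>

text \<open>Since \<open>A\<close> is regular at a_1 with a simple zero there, the preimage under
  \<open>A\<close> of the stalk at a_1 + 1 contains the stalk at a_1 with index one. Taking it as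
  the new stalk makes \<open>A\<close> an isomorphism at a_1 and hands the zero to the map arriving
  from a_1 - 1. The two enlargements raise the degree by 2, the factor z^-1 in rank 2 lowers it by
  2, so degree -1 is kept. At infinity \<open>A\<close> is multiplied by (z + 1)/z = 1 + w, w = 1/z.
  The products (1 + d_j w)(1 + w) agree with 1 + (d_j + 1) w only to first order; a formal diagonal
  gauge removes the rest. Origin of t_j: the w-coefficient of z^-3 A at infinity has eigenvalues
  d_1, d_2, and in the normalised frame its lower right entry is 1 - a_1 - a_2 - t, where the 1
  comes from the frame z^-1 of O(-1). The product of its off-diagonal entries is zero exactly when
  this entry equals d_1 or d_2, that is, when t = t_1 or t = t_2. The formulas are claimed at every
  point where they make sense, so the special positions (t = q, \<open>p\<close> of the form 0/0, r
  = 0) require arguments of their own.\<close>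

lemma matrix_inv_mult_left: "invertible A \<Longrightarrow> matrix_inv A ** A = mat 1"
  and matrix_inv_mult_right: "invertible A \<Longrightarrow> A ** matrix_inv A = mat 1"
  unfolding invertible_def matrix_inv_def by (metis (mono_tags, lifting) someI_ex)+

lemma matrix_inv_eqI:
  fixes A B :: "'a::semiring_1^'n^'n"
  assumes "A ** B = mat 1" "B ** A = mat 1"
  shows "matrix_inv A = B"
proof -
  have "invertible A" using assms by (auto simp: invertible_def)
  then show ?thesis
    by (metis assms(1) matrix_inv_mult_left matrix_mul_assoc matrix_mul_lid matrix_mul_rid)
qed

lemma invertible_matrix_inv: "invertible A \<Longrightarrow> invertible (matrix_inv A)"
  by (metis invertible_def matrix_inv_mult_left matrix_inv_mult_right)

lemma matrix_inv_matrix_inv: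
  fixes A :: "'a::semiring_1^'n^'n"
  shows "invertible A \<Longrightarrow> matrix_inv (matrix_inv A) = A"
  by (simp add: matrix_inv_eqI matrix_inv_mult_left matrix_inv_mult_right)

lemma matrix_inv_mult:
  fixes A B :: "'a::semiring_1^'n^'n"
  assumes "invertible A" "invertible B"
  shows "matrix_inv (A ** B) = matrix_inv B ** matrix_inv A"
proof (rule matrix_inv_eqI)
  have "A ** (B ** matrix_inv B) ** matrix_inv A = mat 1"
    using assms by (simp add: matrix_inv_mult_right)
  then show "A ** B ** (matrix_inv B ** matrix_inv A) = mat 1" by (simp add: matrix_mul_assoc)
  have "matrix_inv B ** (matrix_inv A ** A) ** B = mat 1"
    using assms by (simp add: matrix_inv_mult_left)
  then show "matrix_inv B ** matrix_inv A ** (A ** B) = mat 1" by (simp add: matrix_mul_assoc)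
qed

lemma matrix_inv_cancel:
  fixes A B :: "'a::semiring_1^'n^'n"
  assumes "invertible A"
  shows "matrix_inv A ** (A ** B) = B" "A ** (matrix_inv A ** B) = B"
    "B ** A ** matrix_inv A = B" "B ** matrix_inv A ** A = B"
proof -
  show "matrix_inv A ** (A ** B) = B" "A ** (matrix_inv A ** B) = B"
    using assms by (simp_all only: matrix_mul_assoc matrix_inv_mult_left matrix_inv_mult_right
        matrix_mul_lid)
  show "B ** A ** matrix_inv A = B" "B ** matrix_inv A ** A = B"
    using assms by (simp_all only: matrix_inv_mult_left matrix_inv_mult_right matrix_mul_rid flip:
        matrix_mul_assoc)
qed

lemma matrix_inv_mat_1 [simp]: "matrix_inv (mat 1 :: 'a::semiring_1^'n^'n) = mat 1"
  by (rule matrix_inv_eqI) simp_all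

lemma mat2_nth [simp]:
  "mat2 a b c d $ 1 $ 1 = a" "mat2 a b c d $ 1 $ 2 = b"
  "mat2 a b c d $ 2 $ 1 = c" "mat2 a b c d $ 2 $ 2 = d"
  by (simp_all add: mat2_def)

lemma mat2_eq_iff: "M = N \<longleftrightarrow> M $ 1 $ 1 = N $ 1 $ 1 \<and> M $ 1 $ 2 = N $ 1 $ 2 \<and>
    M $ 2 $ 1 = N $ 2 $ 1 \<and> M $ 2 $ 2 = N $ 2 $ (2::2)" for M N :: "'a^2^2"
  by (simp only: vec_eq_iff forall_2 conj_assoc)

lemma mat2_mult_nth: "(M ** N) $ i $ j = M $ i $ 1 * N $ 1 $ j + M $ i $ 2 * N $ 2 $ j"
  for M N :: "'a::semiring_1^2^2"
  by (simp add: matrix_matrix_mult_def sum_2)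

lemma map_mat_nth [simp]: "map_mat f M $ i $ j = f (M $ i $ j)"
  by (simp add: map_mat_def)

lemma map_mat_map_mat: "map_mat f (map_mat g M) = map_mat (f \<circ> g) M"
  by (simp add: mat2_eq_iff)

lemma mat_nth: "(mat c :: 'a::zero^2^2) $ i $ j = (if i = j then c else 0)"
  by (simp add: mat_def)

text \<open>Instances are the shift, the expansion at infinity, the embedding of power series into
  Laurent series, the shift of power series, and the constant term. Each has to commute with
  products, inverses and determinants of matrices.\<close>

locale ring_map =
  fixes f :: "'a::comm_ring_1 \<Rightarrow> 'b::comm_ring_1"
  assumes add: "f (x + y) = f x + f y" and mult: "f (x * y) = f x * f y"
    and one: "f 1 = 1"
begin

lemma zero: "f 0 = 0"
  using add[of 0 0] by simp

lemma minus: "f (x - y) = f x - f y"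
  using add[of "x - y" y] by (simp add: algebra_simps)

lemma map_mat_mult: "map_mat f (A ** B) = map_mat f A ** map_mat f B"
  by (simp add: mat2_eq_iff mat2_mult_nth add mult)

lemma map_mat_one: "map_mat f (mat 1) = mat 1"
  by (simp add: mat2_eq_iff mat_nth one zero)

lemma invertible: "invertible A \<Longrightarrow> invertible (map_mat f A)"
  unfolding invertible_def by (metis map_mat_mult map_mat_one)

lemma map_matrix_inv: "invertible A \<Longrightarrow> map_mat f (matrix_inv A) = matrix_inv (map_mat f A)"
  by (metis map_mat_mult map_mat_one matrix_inv_eqI matrix_inv_mult_left matrix_inv_mult_right)

lemma det: "det (map_mat f A) = f (det A)"
  by (simp add: det_2 add mult minus)

end

section \<open>Local rings\<close>

lemma nonzero_of_poly: "poly g x \<noteq> 0 \<Longrightarrow> g \<noteq> 0"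
  by auto

lemma regular_at_to_fract: "regular_at (Fin x) (to_fract f)"
  by (simp add: to_fract_def) (metis poly_1 zero_neq_one)

lemma regular_at_const: "regular_at x (to_fract [:c:])"
proof (cases x)
  case Infty
  show ?thesis
    unfolding Infty regular_at.simps to_fract_def
    by (rule exI[of _ "[:c:]"], rule exI[of _ 1]) simp
qed (simp only: regular_at_to_fract)

lemma regular_at_0 [simp]: "regular_at x 0" and regular_at_1 [simp]: "regular_at x 1"
  using regular_at_const[of x 0] regular_at_const[of x 1] by (simp_all add: pCons_one)

lemma regular_at_add:
  assumes "regular_at x h" "regular_at x k"
  shows "regular_at x (h + k)"
proof (cases x)
  case (Fin z)
  obtain f g u v where *: "h = Fraction_Field.Fract f g" "poly g z \<noteq> 0"
      "k = Fraction_Field.Fract u v" "poly v z \<noteq> 0"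
    using assms by (auto simp: Fin)
  then have "h + k = Fraction_Field.Fract (f * v + u * g) (g * v)"
    using nonzero_of_poly[OF *(2)] nonzero_of_poly[OF *(4)] by simp
  then show ?thesis using * by (auto simp: Fin intro!: exI)
next
  case Infty
  obtain f g u v where *: "h = Fraction_Field.Fract f g" "g \<noteq> 0" "degree f \<le> degree g"
      "k = Fraction_Field.Fract u v" "v \<noteq> 0" "degree u \<le> degree v"
    using assms by (auto simp: Infty)
  then have "h + k = Fraction_Field.Fract (f * v + u * g) (g * v)" by auto
  moreover have "degree (f * v + u * g) \<le> degree (g * v)"
    using * by (intro degree_add_le order.trans[OF degree_mult_le]) (auto simp: degree_mult_eq)
  ultimately show ?thesis using * by (auto simp: Infty intro!: exI)
qed

lemma regular_at_mult:
  assumes "regular_at x h" "regular_at x k"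
  shows "regular_at x (h * k)"
proof (cases x)
  case (Fin z)
  obtain f g u v where *: "h = Fraction_Field.Fract f g" "poly g z \<noteq> 0"
      "k = Fraction_Field.Fract u v" "poly v z \<noteq> 0"
    using assms by (auto simp: Fin)
  then have "h * k = Fraction_Field.Fract (f * u) (g * v)" by simp
  then show ?thesis using * by (auto simp: Fin intro!: exI)
next
  case Infty
  obtain f g u v where *: "h = Fraction_Field.Fract f g" "g \<noteq> 0" "degree f \<le> degree g"
      "k = Fraction_Field.Fract u v" "v \<noteq> 0" "degree u \<le> degree v"
    using assms by (auto simp: Infty)
  then have "h * k = Fraction_Field.Fract (f * u) (g * v)" by simp
  moreover have "degree (f * u) \<le> degree (g * v)"
    using * by (intro order.trans[OF degree_mult_le]) (auto simp: degree_mult_eq)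
  ultimately show ?thesis using * by (auto simp: Infty intro!: exI)
qed

lemma regular_at_uminus: "regular_at x h \<Longrightarrow> regular_at x (- h)"
proof -
  have "[:-1:] = (-1 :: complex poly)" by (simp add: one_pCons)
  then show "regular_at x h \<Longrightarrow> regular_at x (- h)"
    using regular_at_mult[OF regular_at_const[of x "-1"], of h] by simp
qed

lemma regular_at_diff: "regular_at x h \<Longrightarrow> regular_at x k \<Longrightarrow> regular_at x (h - k)"
  using regular_at_add[of x h "- k"] by (simp add: regular_at_uminus)

text \<open>In lowest terms the denominator cannot vanish where the function is regular, so it has
  no roots and is constant.\<close>

lemma polynomial_if_regular:
  assumes "\<And>x. regular_at (Fin x) h"
  obtains f where "h = to_fract f"
proof -
  obtain f g where h: "h = Fraction_Field.Fract f g" "g \<noteq> 0" "coprime f g"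
    by (metis Fract_quot_of_fract coprime_quot_of_fract prod.collapse snd_conv fst_conv)
  have "poly g x \<noteq> 0" for x
  proof
    assume gx: "poly g x = 0"
    obtain u v where uv: "h = Fraction_Field.Fract u v" "poly v x \<noteq> 0"
      using assms[of x] by auto
    then have "f * v = u * g" using h(1,2) nonzero_of_poly[OF uv(2)] by (simp add: eq_fract)
    then have "poly f x * poly v x = 0" using gx by (metis mult_zero_right poly_mult)
    then have "poly f x = 0" using uv by simp
    then have "[:- x, 1:] dvd 1" using h(3) gx by (metis coprime_common_divisor poly_eq_0_iff_dvd)
    then show False by (simp add: is_unit_poly_iff) 
  qed
  then have "degree g = 0"
    using fundamental_theorem_of_algebra constant_degree by (metis)
  then obtain c where g: "g = [:c:]" by (metis degree_0_id)
  then have "c \<noteq> 0" using h by auto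
  then have "h = to_fract (smult (1 / c) f)"
    unfolding h(1) g by (simp add: to_fract_def eq_fract)
  then show thesis by (rule that)
qed

lemma degree_le_if_regular_Infty:
  assumes "regular_at Infty (to_fract f / to_fract [:0, 1:] ^ k)"
  shows "degree f \<le> k"
proof (cases "f = 0")
  case False
  have "to_fract f / to_fract [:0, 1:] ^ k = Fraction_Field.Fract f (monom 1 k)"
  proof -
    have "to_fract [:0, 1:] ^ k = to_fract (monom 1 k :: complex poly)"
      by (induction k) (simp_all add: monom_Suc monom_0 pCons_one flip: to_fract_mult)
    then show ?thesis by (simp add: Fract_conv_to_fract)
  qed
  then obtain u v where *: "Fraction_Field.Fract f (monom 1 k) = Fraction_Field.Fract u v"
      "v \<noteq> 0" "degree u \<le> degree v"
    using assms by auto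
  then have "f * v = u * monom 1 k" by (simp add: eq_fract)
  moreover from this have "u \<noteq> 0" using False * by auto
  ultimately have "degree f + degree v = degree u + k"
    using False * by (metis degree_mult_eq degree_monom_eq monom_eq_0_iff one_neq_zero)
  then show ?thesis using * by simp
qed simp

lemma shift_ring_map: "ring_map shift"
proof
  have nz: "pcompose k [:1, 1:] \<noteq> 0" if "k \<noteq> 0" for k :: "complex poly"
    using that by (simp add: pcompose_eq_0_iff)
  fix h k :: ratfun
  obtain f g u v where *: "h = Fraction_Field.Fract f g" "g \<noteq> 0"
      "k = Fraction_Field.Fract u v" "v \<noteq> 0"
    by (metis Fract_quot_of_fract)
  show "shift (h + k) = shift h + shift k" "shift (h * k) = shift h * shift k"
    using * nz by (simp_all add: shift_Fract pcompose_add pcompose_mult)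
next
  show "shift 1 = 1" by (simp add: One_fract_def shift_Fract pcompose_1)
qed

interpretation shift: ring_map shift by (rule shift_ring_map)

lemma shift_to_fract: "shift (to_fract f) = to_fract (pcompose f [:1, 1:])"
  by (simp add: to_fract_def shift_Fract pcompose_1)

lemma regular_at_shift:
  assumes "regular_at (P1_shift x) h"
  shows "regular_at x (shift h)"
proof (cases x)
  case (Fin z)
  obtain f g where *: "h = Fraction_Field.Fract f g" "poly g (z + 1) \<noteq> 0"
    using assms by (auto simp: Fin)
  then have "shift h = Fraction_Field.Fract (pcompose f [:1, 1:]) (pcompose g [:1, 1:])"
    using nonzero_of_poly shift_Fract by blast
  then show ?thesis using * by (auto simp: Fin poly_pcompose add.commute intro!: exI)
next
  case Infty
  obtain f g where *: "h = Fraction_Field.Fract f g" "g \<noteq> 0" "degree f \<le> degree g"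
    using assms by (auto simp: Infty)
  then have "shift h = Fraction_Field.Fract (pcompose f [:1, 1:]) (pcompose g [:1, 1:])"
    using shift_Fract by blast
  then show ?thesis using * by (auto simp: Infty pcompose_eq_0_iff degree_pcompose intro!: exI)
qed

text \<open>The maximal ideal of the local ring at \<open>x\<close>. Unlike
  \<open>simple_zero\<close> it is stable under multiplication by every regular function, and for
  polynomials it means having a root.\<close>

definition vanishes_at :: "complex \<Rightarrow> ratfun \<Rightarrow> bool" where
  "vanishes_at x h \<longleftrightarrow> (\<exists>f g. h = Fraction_Field.Fract f g \<and> poly g x \<noteq> 0 \<and> poly f x = 0)"

lemma vanishes_at_to_fract: "vanishes_at x (to_fract f) \<longleftrightarrow> poly f x = 0"
proof
  assume "vanishes_at x (to_fract f)"
  then obtain u v where *: "to_fract f = Fraction_Field.Fract u v" "poly v x \<noteq> 0" "poly u x = 0"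
    by (auto simp: vanishes_at_def)
  then have "f * v = u" using nonzero_of_poly[OF *(2)] by (simp add: to_fract_def eq_fract)
  then show "poly f x = 0" using * by auto
qed (simp add: vanishes_at_def to_fract_def, metis poly_1 zero_neq_one)

lemma vanishes_at_mult:
  assumes "regular_at (Fin x) h" "vanishes_at x k"
  shows "vanishes_at x (h * k)"
proof -
  obtain f g u v where *: "h = Fraction_Field.Fract f g" "poly g x \<noteq> 0"
      "k = Fraction_Field.Fract u v" "poly v x \<noteq> 0" "poly u x = 0"
    using assms by (auto simp: vanishes_at_def)
  then have "h * k = Fraction_Field.Fract (f * u) (g * v)" by simp
  then show ?thesis using * by (auto simp: vanishes_at_def intro!: exI)
qed

text \<open>Splitting off the factor z - x replaces the order condition by a cofactor that does not
  vanish, a form that passes easily through shifts and products.\<close>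

lemma simple_zero_iff:
  "simple_zero x h \<longleftrightarrow> (\<exists>k g. h = Fraction_Field.Fract ([:- x, 1:] * k) g \<and> poly g x \<noteq> 0 \<and> poly k x
      \<noteq> 0)"
proof
  assume "simple_zero x h"
  then obtain f g where *: "h = Fraction_Field.Fract f g" "poly g x \<noteq> 0" "f \<noteq> 0" "order x f = 1"
    by (auto simp: simple_zero_def)
  obtain k where "f = [:- x, 1:] ^ 1 * k" "\<not> [:- x, 1:] dvd k"
    using order_decomp[OF *(3), of x] *(4) by auto
  then show "\<exists>k g. h = Fraction_Field.Fract ([:- x, 1:] * k) g \<and> poly g x \<noteq> 0 \<and> poly k x \<noteq> 0"
    using * by (auto simp: poly_eq_0_iff_dvd simp del: mult_pCons_left)
next
  assume "\<exists>k g. h = Fraction_Field.Fract ([:- x, 1:] * k) g \<and> poly g x \<noteq> 0 \<and> poly k x \<noteq> 0"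
  then obtain k g where *: "h = Fraction_Field.Fract ([:- x, 1:] * k) g" "poly g x \<noteq> 0" "poly k x
      \<noteq> 0"
    by blast
  have nz: "[:- x, 1:] * k \<noteq> 0" using *(3) by (metis mult_eq_0_iff pCons_eq_0_iff poly_0
      zero_neq_one)
  then have "order x ([:- x, 1:] * k) = 1"
    using order_mult[OF nz] order_power_n_n[of x 1] order_0I[OF *(3)] by simp
  then show "simple_zero x h" unfolding simple_zero_def using * nz by blast
qed

lemma simple_zero_vanishes: "simple_zero x h \<Longrightarrow> vanishes_at x h"
  unfolding simple_zero_def vanishes_at_def by (metis order_root one_neq_zero)

lemma simple_zero_shift:
  assumes "simple_zero (x + 1) h"
  shows "simple_zero x (shift h)"
proof -
  obtain k g where *: "h = Fraction_Field.Fract ([:- (x + 1), 1:] * k) g"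
      "poly g (x + 1) \<noteq> 0" "poly k (x + 1) \<noteq> 0"
    using assms unfolding simple_zero_iff by blast
  have "pcompose [:- (x + 1), 1:] [:1, 1:] = [:- x, 1:]" by (simp add: pcompose_pCons)
  then have "shift h = Fraction_Field.Fract ([:- x, 1:] * pcompose k [:1, 1:]) (pcompose g [:1,
      1:])"
    unfolding *(1) shift_Fract[OF nonzero_of_poly[OF *(2)]] pcompose_mult by (simp only:)
  then show ?thesis
    unfolding simple_zero_iff using *(2,3) by (auto simp: poly_pcompose add.commute intro!: exI
        simp del: mult_pCons_left)
qed

lemma simple_zero_mult_unit:
  assumes "simple_zero x h" "regular_at (Fin x) u" "regular_at (Fin x) v" "u * v = 1"
  shows "simple_zero x (h * u)"
proof -
  obtain k g where *: "h = Fraction_Field.Fract ([:- x, 1:] * k) g" "poly g x \<noteq> 0" "poly k x \<noteq> 0"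
    using assms(1) unfolding simple_zero_iff by blast
  obtain u1 u2 where u: "u = Fraction_Field.Fract u1 u2" "poly u2 x \<noteq> 0" using assms(2) by auto
  \<comment> \<open>Otherwise \<open>u\<close> vanishes at \<open>x\<close>, and so does
    \<open>v * u = 1\<close>.\<close>
  have "poly u1 x \<noteq> 0"
  proof
    assume "poly u1 x = 0"
    then have "vanishes_at x u" using u by (auto simp: vanishes_at_def)
    then have "vanishes_at x (to_fract 1)" using vanishes_at_mult[OF assms(3), of u] assms(4)
      by (simp only: to_fract_1 mult.commute)
    then show False unfolding vanishes_at_to_fract by simp
  qed
  moreover have "h * u = Fraction_Field.Fract ([:- x, 1:] * (k * u1)) (g * u2)"
    unfolding *(1) u(1) by (simp only: mult_fract mult.assoc)
  ultimately show ?thesis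
    unfolding simple_zero_iff using * u(2) by (auto intro!: exI simp del: mult_pCons_left)
qed

section \<open>Matrices over the local rings\<close>

lemma regular_mat_at_mult:
  "regular_mat_at x M \<Longrightarrow> regular_mat_at x N \<Longrightarrow> regular_mat_at x (M ** N)"
  by (simp add: regular_mat_at_def mat2_mult_nth regular_at_add regular_at_mult)

lemma regular_at_det: "regular_mat_at x M \<Longrightarrow> regular_at x (det M)"
  by (simp add: regular_mat_at_def det_2 regular_at_diff regular_at_mult)

lemma unit_mat_at_mult:
  "unit_mat_at x M \<Longrightarrow> unit_mat_at x N \<Longrightarrow> unit_mat_at x (M ** N)"
  by (simp add: unit_mat_at_def matrix_inv_mult invertible_mult regular_mat_at_mult)

lemma unit_mat_at_inv: "unit_mat_at x M \<Longrightarrow> unit_mat_at x (matrix_inv M)"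
  by (simp add: unit_mat_at_def matrix_inv_matrix_inv invertible_matrix_inv)

lemma unit_mat_at_1: "unit_mat_at x (mat 1)"
  by (auto simp: unit_mat_at_def regular_mat_at_def mat_nth invertible_def intro!: exI[of _ "mat
      1"])

lemma regular_mat_at_shift: "regular_mat_at (P1_shift x) M \<Longrightarrow> regular_mat_at x (map_mat shift M)"
  by (simp add: regular_mat_at_def regular_at_shift)

lemma unit_mat_at_shift: "unit_mat_at (P1_shift x) M \<Longrightarrow> unit_mat_at x (map_mat shift M)"
  by (simp add: unit_mat_at_def regular_mat_at_shift shift.invertible flip: shift.map_matrix_inv)

section \<open>Expansions at infinity\<close>

lemma fps_to_fls_ring_map: "ring_map (fps_to_fls :: complex fps \<Rightarrow> complex fls)"
  by standard (simp_all add: fls_times_fps_to_fls)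

interpretation fps_to_fls: ring_map "fps_to_fls :: complex fps \<Rightarrow> complex fls"
  by (rule fps_to_fls_ring_map)

lemma map_mat_fps_to_fls_inj: "map_mat fps_to_fls A = map_mat fps_to_fls B \<Longrightarrow> A = B"
  by (simp add: mat2_eq_iff)

section \<open>The shift as a substitution in power series at infinity\<close>

abbreviation shift_X :: "complex fps" where
  "shift_X \<equiv> fps_X / (1 + fps_X)"

lemma shift_X_mult: "shift_X * (1 + fps_X) = fps_X"
  by (simp add: fps_divide_unit mult.assoc inverse_mult_eq_1)

lemma shift_X_0 [simp]: "fps_nth shift_X 0 = 0"
  by (simp add: fps_divide_unit)

lemma shift_X_1 [simp]: "fps_nth shift_X (Suc 0) = 1"
  by (simp add: fps_divide_unit)

lemma shift_X_nz [simp]: "shift_X \<noteq> 0"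
  using shift_X_1 by (metis fps_zero_nth zero_neq_one)

lemma fps_shift_ring_map: "ring_map fps_shift_at_inf"
  by standard (simp_all add: fps_shift_at_inf_def fps_compose_add_distrib fps_compose_mult_distrib)

interpretation fps_shift: ring_map fps_shift_at_inf by (rule fps_shift_ring_map)

lemma fps_shift_at_inf_0: "fps_nth (fps_shift_at_inf f) 0 = fps_nth f 0"
  by (simp add: fps_shift_at_inf_def)

lemma fps_shift_at_inf_1: "fps_nth (fps_shift_at_inf f) (Suc 0) = fps_nth f (Suc 0)"
  by (simp add: fps_shift_at_inf_def fps_compose_nth)

lemma at_inf_ring_map: "ring_map at_inf"
proof
  fix h k :: ratfun
  obtain f g u v where *: "h = Fraction_Field.Fract f g" "g \<noteq> 0"
      "k = Fraction_Field.Fract u v" "v \<noteq> 0"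
    by (metis Fract_quot_of_fract)
  show "at_inf (h + k) = at_inf h + at_inf k" "at_inf (h * k) = at_inf h * at_inf k"
    using *(2,4) by (simp_all add: *(1,3) at_inf_Fract poly_at_inf_add poly_at_inf_mult
        poly_at_inf_nonzero add_frac_eq)
next
  have "poly_at_inf 1 = 1" by (simp add: poly_at_inf_def)
  then show "at_inf 1 = 1" by (simp add: One_fract_def at_inf_Fract)
qed

interpretation at_inf: ring_map at_inf by (rule at_inf_ring_map)

lemma at_inf_to_fract: "at_inf (to_fract f) = poly_at_inf f"
  unfolding to_fract_def by (subst at_inf_Fract) (simp_all add: poly_at_inf_def)

lemma fls_X_mult_X_inv: "fls_X * fls_X_inv = (1 :: complex fls)"
  by (simp flip: fls_inverse_X)

lemma at_inf_z: "at_inf (to_fract [:0, 1:]) = fls_X_inv"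
  by (simp add: at_inf_to_fract poly_at_inf_pCons)

lemma at_inf_inverse_z: "at_inf (inverse (to_fract [:0, 1:])) = fls_X"
proof -
  have "at_inf (inverse (to_fract [:0, 1:])) * fls_X_inv = 1"
    unfolding at_inf_z[symmetric] at_inf.mult[symmetric] by (simp add: at_inf.one)
  moreover have "fls_X * fls_X_inv = (1 :: complex fls)"
    by (rule fls_X_mult_X_inv)
  ultimately show ?thesis
    by (metis mult_cancel_right mult_zero_right zero_neq_one)
qed

lemma poly_at_inf_shift:
  "poly_at_inf (pcompose f [:1, 1:]) = fls_compose_fps (poly_at_inf f) shift_X"
proof -
  \<comment> \<open>The case of z itself: w -> w/(1 + w) sends 1/w to (1 + w)/w = 1/w + 1.
    Polynomials follow because the substitution respects sums and products.\<close>
  have X: "fls_compose_fps fls_X_inv shift_X = fls_X_inv + 1"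
  proof -
    have "fls_compose_fps fls_X_inv shift_X = inverse (fps_to_fls shift_X)"
      using fls_compose_fps_inverse[of shift_X fls_X] fls_compose_fps_to_fls[of shift_X fps_X]
      by (simp add: fls_inverse_X)
    also have "fps_to_fls shift_X * (fls_X_inv + 1) = 1"
    proof -
      have X: "fls_X * fls_X_inv = (1 :: complex fls)"
        by (rule fls_X_mult_X_inv)
      have "fps_to_fls shift_X * (1 + fls_X) = fls_X"
        using arg_cong[OF shift_X_mult, of fps_to_fls] unfolding fps_to_fls.mult by simp
      then have "fps_to_fls shift_X * (1 + fls_X) * fls_X_inv = 1" using X by simp
      moreover have "u * (i + 1) = 1" if "u * (1 + x) * i = 1" "x * i = 1" for u x i :: "complex
          fls"
        using that by algebra
      ultimately show ?thesis using X by blast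
    qed
    then have "inverse (fps_to_fls shift_X) = fls_X_inv + 1" by (rule inverse_unique)
    finally show ?thesis .
  qed
  have [simp]: "fls_compose_fps (F + G) shift_X = fls_compose_fps F shift_X + fls_compose_fps G
      shift_X"
    "fls_compose_fps (F * G) shift_X = fls_compose_fps F shift_X * fls_compose_fps G shift_X"
    for F G :: "complex fls"
    by (rule fls_compose_fps_add fls_compose_fps_mult; simp)+
  show ?thesis
    by (induction f)
      (simp_all add: pcompose_pCons poly_at_inf_pCons poly_at_inf_add poly_at_inf_mult X
          distrib_right)
qed

lemma at_inf_shift: "at_inf (shift h) = fls_compose_fps (at_inf h) shift_X"
proof -
  obtain f g where h: "h = Fraction_Field.Fract f g" "g \<noteq> 0"
    by (metis Fract_quot_of_fract)
  then have "pcompose g [:1, 1:] \<noteq> 0" by (simp add: pcompose_eq_0_iff)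
  then show ?thesis
    using h fls_compose_fps_divide[OF shift_X_nz shift_X_0]
    by (simp add: shift_Fract at_inf_Fract poly_at_inf_shift)
qed

text \<open>The expansion at infinity of z^-n f. The bound \<open>n\<close> is independent of the
  degree of \<open>f\<close>, so the indices stay aligned when leading coefficients vanish.\<close>

definition reverse_fps :: "nat \<Rightarrow> complex poly \<Rightarrow> complex fps" where
  "reverse_fps n f = Abs_fps (\<lambda>i. if i \<le> n then coeff f (n - i) else 0)"

lemma poly_at_inf_conv_reverse:
  assumes "degree f \<le> n"
  shows "poly_at_inf f * fls_X ^ n = fps_to_fls (reverse_fps n f)"
  using assms
proof (induction n arbitrary: f)
  case 0
  then obtain c where f: "f = [:c:]" by (metis degree_0_id le_zero_eq)
  have "reverse_fps 0 f = fps_const c" by (rule fps_ext) (simp add: reverse_fps_def f)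
  then show ?case by (simp add: f poly_at_inf_pCons)
next
  case (Suc n)
  obtain c g where f: "f = pCons c g" by (cases f)
  have "degree g \<le> n" using Suc.prems by (cases "g = 0") (simp_all add: f)
  note IH = Suc.IH[OF this]
  have X: "fls_X * fls_X_inv = (1 :: complex fls)"
    by (rule fls_X_mult_X_inv)
  have "poly_at_inf f * fls_X ^ Suc n = fls_const c * fls_X ^ Suc n + (fls_X * fls_X_inv) *
      (poly_at_inf g * fls_X ^ n)"
    by (simp add: f poly_at_inf_pCons algebra_simps)
  also have "\<dots> = fps_to_fls (fps_const c * fps_X ^ Suc n + reverse_fps n g)"
    unfolding X IH by (simp add: fps_to_fls.mult fps_to_fls_power)
  also have "fps_const c * fps_X ^ Suc n + reverse_fps n g = reverse_fps (Suc n) f"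
    by (rule fps_ext) (auto simp: reverse_fps_def f fps_X_power_nth coeff_pCons Suc_diff_le split:
        nat.splits)
  finally show ?case .
qed

lemma at_inf_regular:
  assumes "regular_at Infty h"
  obtains k where "at_inf h = fps_to_fls k"
proof -
  obtain f g where h: "h = Fraction_Field.Fract f g" "g \<noteq> 0" "degree f \<le> degree g"
    using assms by auto
  \<comment> \<open>Both parts of the fraction are scaled by w to the degree of the denominator; the
    constant term of the denominator is then its leading coefficient, so it becomes a unit.\<close>
  define kf kg where "kf = reverse_fps (degree g) f" and "kg = reverse_fps (degree g) g"
  have "fps_nth kg 0 \<noteq> 0" using h by (simp add: kg_def reverse_fps_def)
  then have "inverse kg * kg = 1" by (rule inverse_mult_eq_1)
  then have "kf = kf * inverse kg * kg" by (simp add: mult.assoc)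
  then have k: "fps_to_fls kf = fps_to_fls (kf * inverse kg) * fps_to_fls kg"
    by (metis fps_to_fls.mult)
  have "fps_to_fls kg \<noteq> 0" using \<open>fps_nth kg 0 \<noteq> 0\<close> by auto
  then have "fps_to_fls kf / fps_to_fls kg = fps_to_fls (kf * inverse kg)"
    unfolding k by simp
  moreover have "at_inf h = fps_to_fls kf / fps_to_fls kg"
    unfolding kf_def kg_def poly_at_inf_conv_reverse[OF h(3), symmetric]
      poly_at_inf_conv_reverse[OF order.refl, symmetric] using h by (simp add: at_inf_Fract)
  ultimately show thesis using that by simp
qed

text \<open>Regular entries expand without polar part, so \<open>fls_regpart\<close> loses nothing.
  The same for the inverse matrix makes the matrix of power series invertible.\<close>

lemma at_inf_unit_mat:
  assumes "unit_mat_at Infty M"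
  obtains N where "invertible N" "map_mat at_inf M = map_mat fps_to_fls N"
    "map_mat at_inf (map_mat shift M) = map_mat fps_to_fls (map_mat fps_shift_at_inf N)"
proof -
  define r where "r = fls_regpart \<circ> at_inf"
  have r: "map_mat at_inf K = map_mat fps_to_fls (map_mat r K)" if "regular_mat_at Infty K" for K
  proof -
    have "at_inf h = fps_to_fls (r h)" if "regular_at Infty h" for h
      by (rule at_inf_regular[OF that]) (simp add: r_def)
    then show ?thesis using that by (simp add: mat2_eq_iff regular_mat_at_def)
  qed
  have M: "invertible M" "regular_mat_at Infty M" "regular_mat_at Infty (matrix_inv M)"
    using assms by (auto simp: unit_mat_at_def)
  have "map_mat r M ** map_mat r (matrix_inv M) = mat 1"
    using M by (intro map_mat_fps_to_fls_inj)
      (simp add: fps_to_fls.map_mat_mult fps_to_fls.map_mat_one r[symmetric]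
        at_inf.map_mat_one matrix_inv_mult_right flip: at_inf.map_mat_mult)
  moreover have "map_mat r (matrix_inv M) ** map_mat r M = mat 1"
    using M by (intro map_mat_fps_to_fls_inj)
      (simp add: fps_to_fls.map_mat_mult fps_to_fls.map_mat_one r[symmetric]
        at_inf.map_mat_one matrix_inv_mult_left flip: at_inf.map_mat_mult)
  ultimately have "invertible (map_mat r M)" by (auto simp: invertible_def)
  moreover have "map_mat at_inf (map_mat shift M) = map_mat fps_to_fls (map_mat fps_shift_at_inf
      (map_mat r M))"
    using r[OF M(2)] by (simp add: mat2_eq_iff at_inf_shift fps_shift_at_inf_def)
  ultimately show thesis using that r[OF M(2)] by blast
qed

text \<open>The form without an inverse can be multiplied by further gauges and compared coefficient
  by coefficient.\<close>

lemma formal_type_at_inf_iff: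
  "formal_type_at_inf \<theta> X \<longleftrightarrow> (\<exists>R. invertible R \<and>
     map_mat at_inf (local_mat X Infty) ** map_mat fps_to_fls R =
     map_mat fps_to_fls (map_mat fps_shift_at_inf R) **
       mat2 (normal_entry (rho1 \<theta>) (coef_d1 \<theta>) (pole_order \<theta>)) 0
            0 (normal_entry (rho2 \<theta>) (coef_d2 \<theta>) (pole_order \<theta>)))"
proof -
  have *: "matrix_inv (map_mat (\<lambda>r. fps_to_fls (fps_shift_at_inf r)) R) ** N ** map_mat fps_to_fls
      R = K \<longleftrightarrow>
      N ** map_mat fps_to_fls R = map_mat fps_to_fls (map_mat fps_shift_at_inf R) ** K"
    if "invertible R" for R :: "complex fps mat2" and N K
  proof -
    have "map_mat (\<lambda>r. fps_to_fls (fps_shift_at_inf r)) R = map_mat fps_to_fls (map_mat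
        fps_shift_at_inf R)"
      by (simp add: map_mat_map_mat o_def)
    moreover have "invertible (map_mat fps_to_fls (map_mat fps_shift_at_inf R))"
      using that by (intro fps_to_fls.invertible fps_shift.invertible)
    ultimately show ?thesis by (metis matrix_inv_cancel(1,2) matrix_mul_assoc)
  qed
  show ?thesis unfolding formal_type_at_inf_def using * by blast
qed

text \<open>The shift fixes the coefficients of index 0 and 1. Index 0 gives B_0 R_0 = R_0, so B_0 =
  1. In index 1 the unknown R_1 then cancels and leaves B_1 R_0 = R_0 diag(d_1, d_2), which fixes
  the trace and determinant of B_1.\<close>

lemma formal_type_leading_terms:
  fixes B R :: "complex fps mat2"
  assumes R: "invertible R"
    and eq: "B ** R = map_mat fps_shift_at_inf R ** mat2 (1 + fps_const d1 * fps_X) 0 0 (1 +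
        fps_const d2 * fps_X)"
  defines "b \<equiv> \<lambda>i j. fps_nth (B $ i $ j) 0" and "c \<equiv> \<lambda>i j. fps_nth (B $ i $ j) 1"
  shows "b 1 1 = 1" "b 2 2 = 1"
    "c 1 1 + c 2 2 = d1 + d2" "c 1 1 * c 2 2 - c 1 2 * c 2 1 = d1 * d2"
proof -
  interpret ev: ring_map "\<lambda>f :: complex fps. fps_nth f 0"
    by standard simp_all
  obtain x y z w where R0: "x = fps_nth (R $ 1 $ 1) 0" "y = fps_nth (R $ 1 $ 2) 0"
    "z = fps_nth (R $ 2 $ 1) 0" "w = fps_nth (R $ 2 $ 2) 0" by blast
  obtain x1 y1 z1 w1 where R1: "x1 = fps_nth (R $ 1 $ 1) 1" "y1 = fps_nth (R $ 1 $ 2) 1"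
    "z1 = fps_nth (R $ 2 $ 1) 1" "w1 = fps_nth (R $ 2 $ 2) 1" by blast
  have "det (map_mat (\<lambda>f. fps_nth f 0) R) \<noteq> 0"
    using ev.invertible[OF R] by (simp add: invertible_det_nz)
  then have det: "x * w - y * z \<noteq> 0" by (simp add: det_2 R0)
  have e: "B $ 1 $ 1 * R $ 1 $ 1 + B $ 1 $ 2 * R $ 2 $ 1 = fps_shift_at_inf (R $ 1 $ 1) * (1 +
      fps_const d1 * fps_X)"
    "B $ 1 $ 1 * R $ 1 $ 2 + B $ 1 $ 2 * R $ 2 $ 2 = fps_shift_at_inf (R $ 1 $ 2) * (1 + fps_const
        d2 * fps_X)"
    "B $ 2 $ 1 * R $ 1 $ 1 + B $ 2 $ 2 * R $ 2 $ 1 = fps_shift_at_inf (R $ 2 $ 1) * (1 + fps_const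
        d1 * fps_X)"
    "B $ 2 $ 1 * R $ 1 $ 2 + B $ 2 $ 2 * R $ 2 $ 2 = fps_shift_at_inf (R $ 2 $ 2) * (1 + fps_const
        d2 * fps_X)"
    using eq by (simp_all add: mat2_eq_iff mat2_mult_nth)
  have e0: "b 1 1 * x + b 1 2 * z = x" "b 1 1 * y + b 1 2 * w = y"
    "b 2 1 * x + b 2 2 * z = z" "b 2 1 * y + b 2 2 * w = w"
    using e[THEN arg_cong[where f = "\<lambda>f. fps_nth f 0"]]
    by (simp_all add: b_def R0 fps_shift_at_inf_0)
  \<comment> \<open>A row vector is determined by its product with the invertible matrix
    R_0.\<close>
  have solve: "p = s \<and> q = r" if "p * x + q * z = s * x + r * z" "p * y + q * w = s * y + r * w"
      for p q r s
  proof -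
    have "(p - s) * (x * w - y * z) = 0" using that by algebra
    moreover have "(q - r) * (x * w - y * z) = 0" using that by algebra
    ultimately show ?thesis using det by simp
  qed
  have b: "b 1 1 = 1" "b 1 2 = 0" "b 2 1 = 0" "b 2 2 = 1"
    using solve[of "b 1 1" "b 1 2" 1 0] solve[of "b 2 1" "b 2 2" 0 1] e0 by simp_all
  then show "b 1 1 = 1" "b 2 2 = 1" by simp_all
  have e1: "b 1 1 * x1 + c 1 1 * x + (b 1 2 * z1 + c 1 2 * z) = x * d1 + x1"
    "b 1 1 * y1 + c 1 1 * y + (b 1 2 * w1 + c 1 2 * w) = y * d2 + y1"
    "b 2 1 * x1 + c 2 1 * x + (b 2 2 * z1 + c 2 2 * z) = z * d1 + z1"
    "b 2 1 * y1 + c 2 1 * y + (b 2 2 * w1 + c 2 2 * w) = w * d2 + w1"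
    using e[THEN arg_cong[where f = "\<lambda>f. fps_nth f 1"]]
    by (simp_all add: b_def c_def R0 R1 fps_shift_at_inf_0 fps_shift_at_inf_1 fps_mult_nth_1)
  then have e1': "c 1 1 * x + c 1 2 * z = d1 * x" "c 1 1 * y + c 1 2 * w = d2 * y"
    "c 2 1 * x + c 2 2 * z = d1 * z" "c 2 1 * y + c 2 2 * w = d2 * w"
    unfolding b by (simp_all add: algebra_simps)
  have "(k + n) * (x * w - y * z) = (d1 + d2) * (x * w - y * z)"
    "(k * n - l * m) * (x * w - y * z) = d1 * d2 * (x * w - y * z)"
    if "k * x + l * z = d1 * x" "k * y + l * w = d2 * y"
      "m * x + n * z = d1 * z" "m * y + n * w = d2 * w" for k l m n
    using that by (algebra, algebra)
  from this[OF e1'] show "c 1 1 + c 2 2 = d1 + d2" "c 1 1 * c 2 2 - c 1 2 * c 2 1 = d1 * d2"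
    using det by simp_all
qed

text \<open>Comparing the coefficients of \<open>X\<^sup>n\<^sup>+\<^sup>1\<close> in \<open>f(X / (1 + X)) = h(X) f(X)\<close> determines the
  coefficient of \<open>f\<close> with index \<open>n\<close>, provided that \<open>h = 1 + O(X\<^sup>2)\<close>.\<close>

fun gauge_coeff :: "complex fps \<Rightarrow> nat \<Rightarrow> complex" where
  "gauge_coeff h n = (if n = 0 then 1 else
     (\<Sum>i<n. gauge_coeff h i * (fps_nth (shift_X ^ i) (Suc n) - fps_nth h (Suc n - i))) / of_nat n)"

declare gauge_coeff.simps [simp del]

lemma shift_X_power_nth:
  "fps_nth (shift_X ^ n) n = 1" "fps_nth (shift_X ^ n) (Suc n) = - of_nat n"
proof -
  define v where "v = inverse (1 + fps_X :: complex fps)"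
  have v: "fps_nth v 0 = 1" by (simp add: v_def)
  have "v * (1 + fps_X) = 1" unfolding v_def by (rule inverse_mult_eq_1) simp
  then have "fps_nth (v * (1 + fps_X)) 1 = 0" by simp
  then have v1: "fps_nth v 1 = - 1" using v by (simp add: fps_mult_nth_1 add_eq_0_iff)
  have vn: "fps_nth (v ^ n) 0 = 1 \<and> fps_nth (v ^ n) 1 = - of_nat n" for n
    by (induction n) (use v v1 in \<open>simp_all add: fps_mult_nth_1\<close>)
  have "shift_X ^ n = fps_X ^ n * v ^ n"
    by (simp add: fps_divide_unit v_def power_mult_distrib)
  then have "fps_nth (shift_X ^ n) k = (if k < n then 0 else fps_nth (v ^ n) (k - n))" for k
    by (simp only: fps_X_power_mult_nth)
  then show "fps_nth (shift_X ^ n) n = 1" "fps_nth (shift_X ^ n) (Suc n) = - of_nat n"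
    using vn[of n] by simp_all
qed

text \<open>The substitution sends X^m to X^m - m X^(m+1) + ..., so in index m + 1 the coefficient
  f_(m+1) cancels (h_0 = 1) and, as h_1 = 0, the equation expresses m f_m through earlier
  coefficients. For m = 0 it reads 0 = 0, which leaves f_0 = 1 as a free choice.\<close>

lemma scalar_formal_gauge:
  fixes h :: "complex fps"
  assumes "fps_nth h 0 = 1" "fps_nth h 1 = 0"
  obtains f where "fps_nth f 0 = 1" "fps_shift_at_inf f = h * f"
proof
  define f where "f = Abs_fps (gauge_coeff h)"
  show f0: "fps_nth f 0 = 1" by (simp add: f_def gauge_coeff.simps)
  show "fps_shift_at_inf f = h * f"
  proof (rule fps_ext)
    fix n
    show "fps_nth (fps_shift_at_inf f) n = fps_nth (h * f) n"
    proof (cases n)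
      case 0
      then show ?thesis using assms f0 by (simp add: fps_shift_at_inf_0)
    next
      case (Suc m)
      let ?u = "\<lambda>i. fps_nth (shift_X ^ i) (Suc m)"
      define U H where "U = (\<Sum>i<m. fps_nth f i * ?u i)"
        and "H = (\<Sum>i<m. fps_nth f i * fps_nth h (Suc m - i))"
      have "of_nat m * fps_nth f m = (\<Sum>i<m. fps_nth f i * (?u i - fps_nth h (Suc m - i)))"
        unfolding f_def fps_nth_Abs_fps by (subst gauge_coeff.simps) simp
      then have s: "of_nat m * fps_nth f m = U - H"
        by (simp add: right_diff_distrib sum_subtractf U_def H_def)
      have "fps_nth (fps_shift_at_inf f) (Suc m) = U + fps_nth f m * ?u m + fps_nth f (Suc m) * ?u
          (Suc m)"
        by (simp add: U_def fps_shift_at_inf_def fps_compose_nth lessThan_Suc_atMost[symmetric]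
            atLeast0AtMost del: power_Suc)
      also have "\<dots> = H + fps_nth f m * fps_nth h 1 + fps_nth f (Suc m) * fps_nth h 0"
        using s unfolding assms shift_X_power_nth by (simp add: algebra_simps)
      also have "\<dots> = fps_nth (h * f) (Suc m)"
        by (simp add: H_def mult.commute[of h] fps_mult_nth lessThan_Suc_atMost[symmetric]
            atLeast0AtMost)
      finally show ?thesis unfolding Suc .
    qed
  qed
qed

section \<open>Modification of a d-connection\<close>

abbreviation z_fun :: ratfun where
  "z_fun \<equiv> to_fract [:0, 1:]"

text \<open>At \<open>a\<close> and \<open>b\<close> the columns span the preimage under
  \<open>A\<close> of the stalk one step further on. That stalk is read from the old bundle, which
  agrees with the new one at this point only if \<open>a\<close> and \<open>b\<close> do not differ
  by 1.\<close>

definition modified :: "complex \<Rightarrow> complex \<Rightarrow> dconn \<Rightarrow> dconn" where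
  "modified a b X =
     ((\<lambda>x. if x = Fin a \<or> x = Fin b then matrix_inv (snd X) ** map_mat shift (fst X (P1_shift x))
           else if x = Infty then fst X Infty ** mat (inverse z_fun) else fst X x), snd X)"

lemma snd_modified [simp]: "snd (modified a b X) = snd X"
  by (simp add: modified_def)

lemma local_mat_alt: "local_mat X x = matrix_inv (map_mat shift (fst X (P1_shift x))) ** snd X **
    fst X x"
  by (simp add: local_mat_def case_prod_unfold)

lemma mat_mult_2 [simp]:
  fixes M :: "'a::comm_ring_1 mat2"
  shows "mat c ** M = map_mat (\<lambda>h. c * h) M" "M ** mat c = map_mat (\<lambda>h. c * h) M"
  by (simp_all add: mat2_eq_iff mat2_mult_nth mat_def mult.commute)

lemma invertible_mat:
  fixes c :: "'a::field"
  assumes "c \<noteq> 0"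
  shows "invertible (mat c :: 'a mat2)" "matrix_inv (mat c :: 'a mat2) = mat (inverse c)"
proof -
  have "mat c ** mat (inverse c) = (mat 1 :: 'a mat2)" "mat (inverse c) ** mat c = (mat 1 :: 'a
      mat2)"
    using assms by (simp_all add: mat2_eq_iff mat_nth)
  then show "invertible (mat c :: 'a mat2)" "matrix_inv (mat c :: 'a mat2) = mat (inverse c)"
    by (auto simp: invertible_def intro: matrix_inv_eqI)
qed

lemma z_fun_nz [simp]: "z_fun \<noteq> 0" "shift z_fun \<noteq> 0"
  by (simp_all add: shift_to_fract pcompose_pCons)

text \<open>The function (z + 1)/z, which the twist by z^-1 at both ends of \<open>A\<close> leaves
  in the local matrix at infinity. It is a unit there, so the pole order is kept.\<close>

definition shift_quotient :: ratfun where
  "shift_quotient = shift z_fun * inverse z_fun"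

lemma shift_quotient:
  "regular_at Infty shift_quotient" "regular_at Infty (inverse shift_quotient)" "shift_quotient \<noteq> 0"
  "at_inf shift_quotient = 1 + fls_X"
proof -
  have s: "shift z_fun = to_fract [:1, 1:]" by (simp add: shift_to_fract pcompose_pCons)
  have "shift_quotient = Fraction_Field.Fract [:1, 1:] [:0, 1:]"
    "inverse shift_quotient = Fraction_Field.Fract [:0, 1:] [:1, 1:]"
    unfolding shift_quotient_def s Fract_conv_to_fract by (simp_all add: field_simps)
  then show "regular_at Infty shift_quotient" "regular_at Infty (inverse shift_quotient)"
    by (auto intro!: exI)
  show "shift_quotient \<noteq> 0" by (simp add: shift_quotient_def)
  show "at_inf shift_quotient = 1 + fls_X"
    using fls_X_mult_X_inv unfolding shift_quotient_def s at_inf.mult at_inf_inverse_z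
        at_inf_to_fract
    by (simp add: poly_at_inf_pCons distrib_left distrib_right mult.commute)
qed

lemma shift_inverse: "shift (inverse h) = inverse (shift h)"
proof (cases "h = 0")
  case False
  then have "shift h * shift (inverse h) = 1" by (simp add: shift.one flip: shift.mult)
  then show ?thesis by (metis inverse_unique)
qed (simp add: shift.zero)

context
  fixes X :: dconn and a b :: complex
  assumes X: "is_dconn X"
    and ab: "b \<noteq> a + 1" "a \<noteq> b + 1"
begin

lemma X_invertible: "invertible (fst X x)" "invertible (snd X)"
  using X by (simp_all add: is_dconn_def is_bundle_def)

lemma is_dconn_modified: "is_dconn (modified a b X)"
proof -
  have "invertible (fst (modified a b X) x)" for x
    unfolding modified_def using X_invertible
    by (auto intro!: invertible_mult invertible_matrix_inv shift.invertible simp: invertible_mat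
        simp del: mat_mult_2)
  moreover have "finite {x. \<not> unit_mat_at x (fst (modified a b X) x)}"
  proof (rule finite_subset)
    show "{x. \<not> unit_mat_at x (fst (modified a b X) x)} \<subseteq>
        {Fin a, Fin b, Infty} \<union> {x. \<not> unit_mat_at x (fst X x)}"
      by (auto simp: modified_def split: if_splits)
    show "finite ({Fin a, Fin b, Infty} \<union> {x. \<not> unit_mat_at x (fst X x)})"
      using X by (simp add: is_dconn_def is_bundle_def)
  qed
  ultimately show ?thesis using X_invertible by (simp add: is_dconn_def is_bundle_def)
qed

lemma local_mat_modified_Infty:
  "local_mat (modified a b X) Infty = map_mat (\<lambda>h. shift_quotient * h) (local_mat X Infty)"
proof -
  let ?L = "map_mat shift (fst X Infty)"
  have sh: "map_mat shift (mat (inverse z_fun) :: ratfun mat2) = mat (inverse (shift z_fun))"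
    by (simp add: mat2_eq_iff mat_def shift_inverse shift.zero)
  have "matrix_inv (?L ** mat (inverse (shift z_fun))) = mat (shift z_fun) ** matrix_inv ?L"
    by (subst matrix_inv_mult)
      (simp_all add: invertible_mat shift.invertible X_invertible del: mat_mult_2)
  then have "local_mat (modified a b X) Infty =
      mat (shift z_fun) ** matrix_inv ?L ** snd X ** (fst X Infty ** mat (inverse z_fun))"
    unfolding local_mat_alt modified_def by (simp add: shift.map_mat_mult sh del: mat_mult_2)
  also have "\<dots> = mat (shift z_fun) ** (matrix_inv ?L ** snd X ** fst X Infty) ** mat (inverse
      z_fun)"
    by (simp only: matrix_mul_assoc)
  finally show ?thesis
    unfolding local_mat_alt by (simp add: map_mat_map_mat o_def shift_quotient_def mult_ac)
qed

lemma local_mat_modified_same: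
  assumes "x \<notin> {a, b}" "x + 1 \<notin> {a, b}"
  shows "local_mat (modified a b X) (Fin x) = local_mat X (Fin x)"
  using assms by (auto simp: local_mat_alt modified_def)

text \<open>The new frame at \<open>x\<close> is \<open>A\<close> inverse applied to the frame at
  \<open>x + 1\<close>, and \<open>ab\<close> ensures that the latter is still the old one.\<close>

lemma local_mat_modified_at:
  assumes "x \<in> {a, b}"
  shows "local_mat (modified a b X) (Fin x) = mat 1"
proof -
  have *: "fst (modified a b X) (Fin x) = matrix_inv (snd X) ** map_mat shift (fst X (Fin (x + 1)))"
    "fst (modified a b X) (Fin (x + 1)) = fst X (Fin (x + 1))"
    using assms ab by (auto simp: modified_def)
  then show ?thesis
    by (simp add: local_mat_alt matrix_inv_cancel matrix_inv_mult_left X_invertible shift.invertible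
        flip: matrix_mul_assoc)
qed

text \<open>Arriving in the new stalk at \<open>x + 1\<close> amounts, in the old frames, to
  applying \<open>A\<close> once more. The matrix at \<open>x\<close> is therefore the composite of
  two steps, and the zero at \<open>x + 1\<close> becomes visible at \<open>x\<close>.\<close>

lemma local_mat_modified_before:
  assumes "x + 1 \<in> {a, b}"
  shows "local_mat (modified a b X) (Fin x) =
    map_mat shift (local_mat X (Fin (x + 1))) ** local_mat X (Fin x)"
proof -
  have "x \<notin> {a, b}" using assms ab by auto
  then have *: "fst (modified a b X) (Fin (x + 1)) = matrix_inv (snd X) ** map_mat shift (fst X
      (Fin (x + 1 + 1)))"
    "fst (modified a b X) (Fin x) = fst X (Fin x)"
    using assms by (auto simp: modified_def)
  show ?thesis
    by (simp add: local_mat_alt * shift.map_mat_mult shift.map_matrix_inv matrix_inv_mult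
        matrix_inv_matrix_inv
        matrix_inv_cancel X_invertible shift.invertible invertible_matrix_inv flip:
            matrix_mul_assoc)
qed

end

text \<open>The modification changes lattices but neither the generic fibre nor \<open>A\<close>, so
  the identity matrix is a rational isomorphism.\<close>

lemma rationally_iso_modified: "rationally_iso (modified a b X) X"
  unfolding rationally_iso_def
  by (rule exI[of _ "mat 1"]) (auto simp: shift.map_mat_one invertible_def intro: exI[of _ "mat
      1"] simp del: mat_mult_2)

lemma simple_zero_det_unit:
  assumes "simple_zero x (det M)" "unit_mat_at (Fin x) N"
  shows "simple_zero x (det (M ** N))"
  unfolding det_mul
proof (rule simple_zero_mult_unit[OF assms(1)])
  show "regular_at (Fin x) (det N)" "regular_at (Fin x) (det (matrix_inv N))"
    using assms(2) unfolding unit_mat_at_def by (blast intro: regular_at_det)+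
  show "det N * det (matrix_inv N) = 1"
    using assms(2) by (simp add: unit_mat_at_def matrix_inv_mult_right flip: det_mul)
qed

text \<open>By \<open>nonres\<close> the old matrix is a unit at a - 1 and b - 1, so the composite
  there has exactly the simple zero brought over from \<open>a\<close> or \<open>b\<close>. The same
  hypothesis keeps the new list of zeros distinct.\<close>

lemma zeros_poles_modified:
  assumes X: "is_dconn X" "zeros_poles_of_type \<theta> X"
    and zeros: "zeros \<theta> = a # b # zs" "zeros \<theta>' = (a - 1) # (b - 1) # zs"
    and order: "pole_order \<theta>' = pole_order \<theta>"
    and nonres: "\<And>x y. x \<in> set (zeros \<theta>) \<Longrightarrow> y \<in> set (zeros \<theta>) \<Longrightarrow> x \<noteq> y + 1"
  shows "zeros_poles_of_type \<theta>' (modified a b X)"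
proof -
  have dist: "distinct (zeros \<theta>)"
    and unit: "\<And>x. x \<notin> set (zeros \<theta>) \<Longrightarrow> unit_mat_at (Fin x) (local_mat X (Fin x))"
    and zero: "\<And>x. x \<in> set (zeros \<theta>) \<Longrightarrow> regular_mat_at (Fin x) (local_mat X (Fin x))"
      "\<And>x. x \<in> set (zeros \<theta>) \<Longrightarrow> simple_zero x (det (local_mat X (Fin x)))"
    and pole: "\<And>m. regular_mat_at Infty (map_mat (\<lambda>h. h / z_fun ^ m) (local_mat X Infty)) \<longleftrightarrow>
        pole_order \<theta> \<le> m"
    using X(2) by (auto simp: zeros_poles_of_type_def)
  have ab: "b \<noteq> a + 1" "a \<noteq> b + 1" using nonres[of b a] nonres[of a b] by (auto simp: zeros)
  have nonres': "x - 1 \<notin> set (zeros \<theta>)" "x + 1 \<notin> set (zeros \<theta>)" if "x \<in> set (zeros \<theta>)" for x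
    using nonres[OF that] nonres[OF _ that] by (metis diff_add_cancel, blast)
  note same = local_mat_modified_same[OF X(1) ab]
    and at = local_mat_modified_at[OF X(1) ab] and before = local_mat_modified_before[OF X(1) ab]
  let ?Y = "modified a b X"
  have "distinct (zeros \<theta>')"
    using dist nonres'(1)[of a] nonres'(1)[of b] by (auto simp: zeros)
  moreover have "unit_mat_at (Fin x) (local_mat ?Y (Fin x))" if "x \<notin> set (zeros \<theta>')" for x
  proof (cases "x \<in> {a, b}")
    case True
    then show ?thesis using at[OF True] by (simp add: unit_mat_at_1)
  next
    case False
    moreover from that have "x + 1 \<notin> {a, b}" by (auto simp: zeros)
    ultimately show ?thesis using same[of x] unit[of x] that by (auto simp: zeros)
  qed
  moreover have "regular_mat_at (Fin x) (local_mat ?Y (Fin x)) \<and> simple_zero x (det (local_mat ?Y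
      (Fin x)))"
    if x: "x \<in> set (zeros \<theta>')" for x
  proof (cases "x + 1 \<in> {a, b}")
    case True
    then have x1: "x + 1 \<in> set (zeros \<theta>)" by (auto simp: zeros)
    then have u: "unit_mat_at (Fin x) (local_mat X (Fin x))"
      using nonres'(1)[of "x + 1"] by (intro unit) simp
    have "simple_zero x (det (map_mat shift (local_mat X (Fin (x + 1)))))"
      unfolding shift.det by (intro simple_zero_shift zero x1)
    moreover have "regular_mat_at (Fin x) (map_mat shift (local_mat X (Fin (x + 1))))"
      by (intro regular_mat_at_shift) (simp add: zero x1)
    ultimately show ?thesis
      unfolding before[OF True] using u
      by (auto intro: simple_zero_det_unit regular_mat_at_mult simp: unit_mat_at_def)
  next
    case False
    then have "x \<in> set zs" using x by (auto simp: zeros)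
    moreover from this have "x \<notin> {a, b}" using dist by (auto simp: zeros)
    ultimately show ?thesis using same[of x] zero[of x] False by (auto simp: zeros)
  qed
  moreover have "regular_mat_at Infty (map_mat (\<lambda>h. h / z_fun ^ m) (local_mat ?Y Infty)) \<longleftrightarrow>
      pole_order \<theta>' \<le> m" for m
  proof -
    have "regular_at Infty (shift_quotient * h) \<longleftrightarrow> regular_at Infty h" for h
      using regular_at_mult[OF shift_quotient(1), of h] shift_quotient(3)
        regular_at_mult[OF shift_quotient(2), of "shift_quotient * h"] by (auto simp:
            mult.assoc[symmetric])
    then have "regular_mat_at Infty (map_mat (\<lambda>h. h / z_fun ^ m) (local_mat ?Y Infty)) \<longleftrightarrow>
        regular_mat_at Infty (map_mat (\<lambda>h. h / z_fun ^ m) (local_mat X Infty))"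
      unfolding local_mat_modified_Infty[OF X(1) ab]
      by (simp add: regular_mat_at_def flip: times_divide_eq_right)
    then show ?thesis using pole order by simp
  qed
  ultimately show ?thesis by (simp add: zeros_poles_of_type_def)
qed

lemma formal_type_modified:
  assumes X: "is_dconn X" "formal_type_at_inf \<theta> X" and ab: "b \<noteq> a + 1" "a \<noteq> b + 1"
    and \<theta>': "rho1 \<theta>' = rho1 \<theta>" "rho2 \<theta>' = rho2 \<theta>" "coef_d1 \<theta>' = coef_d1 \<theta> + 1"
      "coef_d2 \<theta>' = coef_d2 \<theta> + 1" "pole_order \<theta>' = pole_order \<theta>"
  shows "formal_type_at_inf \<theta>' (modified a b X)"
proof -
  obtain R where R: "invertible R"
     "map_mat at_inf (local_mat X Infty) ** map_mat fps_to_fls R =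
     map_mat fps_to_fls (map_mat fps_shift_at_inf R) **
       mat2 (normal_entry (rho1 \<theta>) (coef_d1 \<theta>) (pole_order \<theta>)) 0
            0 (normal_entry (rho2 \<theta>) (coef_d2 \<theta>) (pole_order \<theta>))"
    using X(2) unfolding formal_type_at_inf_iff by blast
  have gauge: "\<exists>f. fps_nth f 0 = 1 \<and> (\<forall>\<rho> n. normal_entry \<rho> d n * ((1 + fls_X) * fps_to_fls f) =
      fps_to_fls (fps_shift_at_inf f) * normal_entry \<rho> (d + 1) n)" for d
  proof -
    define k where "k = 1 + fps_const (d + 1) * fps_X"
    \<comment> \<open>The expansion obtained, (1 + d X)(1 + X), divided by the one desired, 1 + (d +
      1) X. The X-coefficient d + 1 - (d + 1) is 0, which is the condition for a scalar gauge; this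
      is why d_j grows by exactly 1.\<close>
    define h where "h = (1 + fps_const d * fps_X) * (1 + fps_X) * inverse k"
    have "k * inverse k = 1" by (rule inverse_mult_eq_1') (simp add: k_def)
    then have hk: "h * k = (1 + fps_const d * fps_X) * (1 + fps_X)"
      by (simp add: h_def mult.assoc mult.commute[of _ k])
    have h0: "fps_nth h 0 = 1" by (simp add: h_def k_def)
    have "fps_nth (h * k) 1 = d + 1" unfolding hk by (simp add: fps_mult_nth_1)
    then have h1: "fps_nth h 1 = 0" using h0 by (simp add: fps_mult_nth_1 k_def)
    obtain f where f: "fps_nth f 0 = 1" "fps_shift_at_inf f = h * f"
      using scalar_formal_gauge[OF h0 h1] by metis
    have "fps_to_fls (h * k) = (1 + fls_const d * fls_X) * (1 + fls_X)"
      unfolding hk by (simp add: fps_to_fls.mult)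
    moreover have "fps_to_fls k = 1 + fls_const (d + 1) * fls_X" by (simp add: k_def
        fps_to_fls.mult)
    ultimately have "fps_to_fls h * (1 + fls_const (d + 1) * fls_X) = (1 + fls_const d * fls_X) *
        (1 + fls_X)"
      by (simp add: fps_to_fls.mult)
    moreover have "r * (x * D) * (Y * g) = H * g * (r * (x * K))" if "H * K = D * Y"
      for r x D Y g H K :: "complex fls"
      using that by algebra
    ultimately have "normal_entry \<rho> d n * ((1 + fls_X) * fps_to_fls f) =
      fps_to_fls (fps_shift_at_inf f) * normal_entry \<rho> (d + 1) n" for \<rho> n
      unfolding f(2) fps_to_fls.mult normal_entry_def by blast
    then show ?thesis using f(1) by blast
  qed
  obtain f1 where f1: "fps_nth f1 0 = 1" "\<And>\<rho> n. normal_entry \<rho> (coef_d1 \<theta>) n * ((1 + fls_X) *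
      fps_to_fls f1) =
      fps_to_fls (fps_shift_at_inf f1) * normal_entry \<rho> (coef_d1 \<theta> + 1) n"
    using gauge[of "coef_d1 \<theta>"] by blast
  obtain f2 where f2: "fps_nth f2 0 = 1" "\<And>\<rho> n. normal_entry \<rho> (coef_d2 \<theta>) n * ((1 + fls_X) *
      fps_to_fls f2) =
      fps_to_fls (fps_shift_at_inf f2) * normal_entry \<rho> (coef_d2 \<theta> + 1) n"
    using gauge[of "coef_d2 \<theta>"] by blast
  define F where "F = mat2 f1 0 0 f2"
  have "F ** mat2 (inverse f1) 0 0 (inverse f2) = mat 1" "mat2 (inverse f1) 0 0 (inverse f2) ** F
      = mat 1"
    using f1(1) f2(1) by (simp_all add: F_def mat2_eq_iff mat2_mult_nth mat_nth inverse_mult_eq_1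
        inverse_mult_eq_1')
  then have F: "invertible F" by (auto simp: invertible_def)
  let ?N = "mat2 (normal_entry (rho1 \<theta>) (coef_d1 \<theta>) (pole_order \<theta>)) 0
            0 (normal_entry (rho2 \<theta>) (coef_d2 \<theta>) (pole_order \<theta>))"
  let ?N' = "mat2 (normal_entry (rho1 \<theta>') (coef_d1 \<theta>') (pole_order \<theta>')) 0
            0 (normal_entry (rho2 \<theta>') (coef_d2 \<theta>') (pole_order \<theta>'))"
  have N: "?N ** (mat (1 + fls_X) ** map_mat fps_to_fls F) = map_mat fps_to_fls (map_mat
      fps_shift_at_inf F) ** ?N'"
    by (simp add: mat2_eq_iff mat2_mult_nth F_def fps_shift.zero f1(2) f2(2) \<theta>')
  have "map_mat at_inf (local_mat (modified a b X) Infty) = map_mat at_inf (local_mat X Infty) **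
      mat (1 + fls_X)"
    unfolding local_mat_modified_Infty[OF X(1) ab]
    by (simp add: mat2_eq_iff at_inf.mult shift_quotient(4))
  moreover have "mat (1 + fls_X) ** map_mat fps_to_fls R = map_mat fps_to_fls R ** mat (1 + fls_X)"
    by simp
  ultimately have "map_mat at_inf (local_mat (modified a b X) Infty) ** map_mat fps_to_fls (R **
      F) =
      map_mat at_inf (local_mat X Infty) ** map_mat fps_to_fls R ** (mat (1 + fls_X) ** map_mat
          fps_to_fls F)"
    unfolding fps_to_fls.map_mat_mult by (metis matrix_mul_assoc)
  also have "\<dots> = map_mat fps_to_fls (map_mat fps_shift_at_inf R) ** (?N ** (mat (1 + fls_X) **
      map_mat fps_to_fls F))"
    unfolding R(2) by (simp only: matrix_mul_assoc)
  also have "\<dots> = map_mat fps_to_fls (map_mat fps_shift_at_inf (R ** F)) ** ?N'"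
    unfolding N fps_shift.map_mat_mult fps_to_fls.map_mat_mult by (simp only: matrix_mul_assoc)
  finally show ?thesis
    unfolding formal_type_at_inf_iff using invertible_mult[OF R(1) F] by blast
qed

section \<open>Passing to a global frame\<close>

lemma O_sum_invertible: "invertible (O_sum k l x)"
proof (cases x)
  case (Fin z)
  have "invertible (mat 1 :: ratfun mat2)"
    unfolding invertible_def by (rule exI[of _ "mat 1"]) (simp del: mat_mult_2)
  then show ?thesis using Fin by simp
next
  case Infty
  then show ?thesis by (simp add: invertible_det_nz det_2)
qed

lemma gauge_frame:
  assumes "invertible S"
  shows "map_mat shift S ** gauge S A = A ** S"
  using assms by (simp add: gauge_def matrix_inv_cancel shift.invertible flip: matrix_mul_assoc)

text \<open>When \<open>S\<close> is a bundle isomorphism the transition matrices on both sides are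
  units, so the identity carries local conditions between \<open>X\<close> and the matrix of
  \<open>A\<close> in a global frame.\<close>

lemma local_mat_frame:
  assumes "\<And>x. invertible (fst X x)" "\<And>x. invertible (L x)" "invertible S"
  shows "local_mat X x ** (matrix_inv (fst X x) ** S ** L x) =
    map_mat shift (matrix_inv (fst X (P1_shift x)) ** S ** L (P1_shift x)) ** local_mat (L, gauge
        S (snd X)) x"
proof -
  have "local_mat X x ** (matrix_inv (fst X x) ** S ** L x) =
      matrix_inv (map_mat shift (fst X (P1_shift x))) ** (snd X ** S) ** L x"
    by (simp add: local_mat_alt matrix_inv_cancel assms flip: matrix_mul_assoc)
  then show ?thesis
    unfolding gauge_frame[OF assms(3), of "snd X", symmetric]
    using assms by (simp add: local_mat_alt shift.map_mat_mult shift.map_matrix_inv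
        matrix_inv_cancel
        shift.invertible flip: matrix_mul_assoc)
qed

lemma formal_type_frame:
  assumes X: "is_dconn X" and L: "\<And>x. invertible (L x)" and S: "bundle_iso S L (fst X)"
    and formal: "formal_type_at_inf \<theta> X"
  shows "formal_type_at_inf \<theta> (L, gauge S (snd X))"
proof -
  let ?A = "local_mat (L, gauge S (snd X)) Infty"
  define N where "N = matrix_inv (fst X Infty) ** S ** L Infty"
  have "unit_mat_at Infty N" and Si: "invertible S" using S by (auto simp: N_def bundle_iso_def)
  then obtain M where M: "invertible M" "map_mat at_inf N = map_mat fps_to_fls M"
    "map_mat at_inf (map_mat shift N) = map_mat fps_to_fls (map_mat fps_shift_at_inf M)"
    using at_inf_unit_mat by metis
  have "local_mat X Infty ** N = map_mat shift N ** ?A"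
    using local_mat_frame[of X L S Infty] X L Si by (simp add: N_def is_dconn_def is_bundle_def)
  then have AN: "map_mat at_inf (local_mat X Infty) ** map_mat fps_to_fls M =
      map_mat fps_to_fls (map_mat fps_shift_at_inf M) ** map_mat at_inf ?A"
    by (metis at_inf.map_mat_mult M(2,3))
  obtain R K where R: "invertible R" and RK: "map_mat at_inf (local_mat X Infty) ** map_mat
      fps_to_fls R =
     map_mat fps_to_fls (map_mat fps_shift_at_inf R) ** K"
    and K: "K = mat2 (normal_entry (rho1 \<theta>) (coef_d1 \<theta>) (pole_order \<theta>)) 0
            0 (normal_entry (rho2 \<theta>) (coef_d2 \<theta>) (pole_order \<theta>))"
    using formal unfolding formal_type_at_inf_iff by blast
  \<comment> \<open>The normalising formal frame, rewritten in terms of the global frame by the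
    transition matrix \<open>M\<close> at infinity.\<close>
  define R' where "R' = matrix_inv M ** R"
  have R: "invertible R'" "R = M ** R'"
    using R M(1) by (simp_all add: R'_def invertible_mult invertible_matrix_inv matrix_inv_cancel)
  define M' where "M' = map_mat fps_to_fls (map_mat fps_shift_at_inf M)"
  have M': "invertible M'" unfolding M'_def by (intro fps_to_fls.invertible fps_shift.invertible
      M(1))
  have "M' ** (map_mat at_inf ?A ** map_mat fps_to_fls R') =
      map_mat at_inf (local_mat X Infty) ** map_mat fps_to_fls M ** map_mat fps_to_fls R'"
    unfolding AN M'_def by (simp only: matrix_mul_assoc)
  also have "\<dots> = M' ** (map_mat fps_to_fls (map_mat fps_shift_at_inf R') ** K)"
    using RK unfolding R(2) fps_to_fls.map_mat_mult fps_shift.map_mat_mult M'_def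
    by (simp only: matrix_mul_assoc)
  finally have "M' ** (map_mat at_inf ?A ** map_mat fps_to_fls R') =
      M' ** (map_mat fps_to_fls (map_mat fps_shift_at_inf R') ** K)" .
  then have "map_mat at_inf ?A ** map_mat fps_to_fls R' = map_mat fps_to_fls (map_mat
      fps_shift_at_inf R') ** K"
    by (metis M' matrix_inv_cancel(1))
  then show ?thesis unfolding formal_type_at_inf_iff K using R(1) by blast
qed

text \<open>O(-1) has the frame z^-1 at infinity. It multiplies the second column, while the inverse
  of its shift puts z + 1 into the second row.\<close>

lemma local_mat_O_sum_Infty:
  "local_mat (O_sum 0 (-1), map_mat to_fract (mat2 a11 a12 a21 a22)) Infty =
     mat2 (to_fract a11) (to_fract a12 * inverse z_fun)
       (to_fract ([:1, 1:] * a21)) (to_fract ([:1, 1:] * a22) * inverse z_fun)"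
proof -
  have s: "shift z_fun = to_fract [:1, 1:]" by (simp add: shift_to_fract pcompose_pCons)
  have nz: "to_fract [:1, 1 :: complex:] \<noteq> 0" by simp
  have "matrix_inv (map_mat shift (O_sum 0 (-1) Infty)) = mat2 1 0 0 (to_fract [:1, 1:])"
    using nz by (intro matrix_inv_eqI)
      (simp_all add: mat2_eq_iff mat2_mult_nth mat_nth shift.one shift.zero shift_inverse s del:
          to_fract_eq_0_iff)
  then show ?thesis
    by (simp add: local_mat_alt mat2_eq_iff mat2_mult_nth to_fract_mult del: mult_pCons_left)
qed

text \<open>After division by z^3 the frame of O(-1) contributes (z + 1)/z to the lower right entry,
  hence the added 1, and moves the leading coefficients of \<open>a12\<close> and \<open>a21\<close>
  to the coefficient of w. The conclusions are the identity constant term and the trace and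
  determinant of the next term.\<close>

lemma frame_leading_coefficients:
  assumes formal: "formal_type_at_inf \<theta> (O_sum 0 (-1), map_mat to_fract (mat2 a11 a12 a21 a22))"
    and \<theta>: "rho1 \<theta> = 1" "rho2 \<theta> = 1" "pole_order \<theta> = 3"
    and deg: "degree a11 \<le> 3" "degree a12 \<le> 3" "degree a21 \<le> 1" "degree a22 \<le> 3"
  shows "coeff a11 3 = 1" "coeff a22 3 = 1"
    "coeff a11 2 + coeff a22 2 + 1 = coef_d1 \<theta> + coef_d2 \<theta>"
    "coeff a11 2 * (coeff a22 2 + 1) - coeff a12 3 * coeff a21 1 = coef_d1 \<theta> * coef_d2 \<theta>"
proof -
  define e21 e22 where "e21 = [:1, 1:] * a21" and "e22 = [:1, 1:] * a22"
  define B where "B = mat2 (reverse_fps 3 a11) (fps_X * reverse_fps 3 a12)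
      (reverse_fps 3 e21) (reverse_fps 4 e22)"
  let ?A = "map_mat at_inf (local_mat (O_sum 0 (-1), map_mat to_fract (mat2 a11 a12 a21 a22))
      Infty)"
  have deg': "degree e21 \<le> 3" "degree e22 \<le> 4"
    unfolding e21_def e22_def using degree_mult_le[of "[:1, 1:]" a21] degree_mult_le[of "[:1, 1:]"
        a22] deg by simp_all
  have c: "fls_X ^ n * at_inf (to_fract f) = fps_to_fls (reverse_fps n f)" if "degree f \<le> n" for n f
    using poly_at_inf_conv_reverse[OF that] by (simp only: at_inf_to_fract mult.commute)
  have "fls_X ^ 3 * (at_inf (to_fract a12) * fls_X) = fls_X * fps_to_fls (reverse_fps 3 a12)"
    unfolding c[OF deg(2), symmetric] by (simp only: mult_ac)
  moreover have "fls_X ^ 3 * (at_inf (to_fract e22) * fls_X) = fps_to_fls (reverse_fps 4 e22)"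
  proof -
    have "fls_X ^ 4 = fls_X ^ 3 * (fls_X :: complex fls)" by (simp add: numeral_eq_Suc)
    then show ?thesis unfolding c[OF deg'(2), symmetric] by (simp only: mult_ac)
  qed
  ultimately have A: "?A ** mat (fls_X ^ 3) = map_mat fps_to_fls B"
    unfolding local_mat_O_sum_Infty e21_def[symmetric] e22_def[symmetric]
    by (simp add: B_def mat2_eq_iff at_inf.mult at_inf_inverse_z fps_to_fls.mult c[OF deg(1)] c[OF
        deg'(1)])
  obtain R where R: "invertible R" and eq: "?A ** map_mat fps_to_fls R =
     map_mat fps_to_fls (map_mat fps_shift_at_inf R) **
       mat2 (normal_entry 1 (coef_d1 \<theta>) 3) 0 0 (normal_entry 1 (coef_d2 \<theta>) 3)"
    using formal unfolding formal_type_at_inf_iff \<theta> by blast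
  let ?K = "\<lambda>d. 1 + fps_const d * fps_X :: complex fps"
  have K: "fls_X ^ 3 * normal_entry 1 d 3 = fps_to_fls (?K d)" for d
  proof -
    have "fls_X ^ 3 * normal_entry 1 d 3 = (fls_X * fls_X_inv) ^ 3 * (1 + fls_const d * fls_X)"
      by (simp add: normal_entry_def power_mult_distrib mult_ac)
    then show ?thesis unfolding fls_X_mult_X_inv by (simp add: fps_to_fls.mult)
  qed
  have "map_mat fps_to_fls (B ** R) = ?A ** map_mat fps_to_fls R ** mat (fls_X ^ 3)"
    unfolding fps_to_fls.map_mat_mult A[symmetric]
    by (simp add: mat2_eq_iff mat2_mult_nth algebra_simps)
  also have "\<dots> = map_mat fps_to_fls (map_mat fps_shift_at_inf R) **
       (mat2 (normal_entry 1 (coef_d1 \<theta>) 3) 0 0 (normal_entry 1 (coef_d2 \<theta>) 3) ** mat (fls_X ^ 3))"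
    unfolding eq by (simp only: matrix_mul_assoc)
  also have "mat2 (normal_entry 1 (coef_d1 \<theta>) 3) 0 0 (normal_entry 1 (coef_d2 \<theta>) 3) ** mat (fls_X
      ^ 3) =
      map_mat fps_to_fls (mat2 (?K (coef_d1 \<theta>)) 0 0 (?K (coef_d2 \<theta>)))"
    by (simp add: mat2_eq_iff K)
  finally have "B ** R = map_mat fps_shift_at_inf R ** mat2 (?K (coef_d1 \<theta>)) 0 0 (?K (coef_d2 \<theta>))"
    unfolding fps_to_fls.map_mat_mult[symmetric] by (rule map_mat_fps_to_fls_inj)
  note lead = formal_type_leading_terms[OF R this]
  \<comment> \<open>Coefficients just above the degree bounds, which enter through the factor z +
    1.\<close>
  have "coeff a21 2 = 0" "coeff a22 4 = 0"
    using deg by (auto intro: coeff_eq_0)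
  then show "coeff a11 3 = 1" "coeff a22 3 = 1"
    "coeff a11 2 + coeff a22 2 + 1 = coef_d1 \<theta> + coef_d2 \<theta>"
    "coeff a11 2 * (coeff a22 2 + 1) - coeff a12 3 * coeff a21 1 = coef_d1 \<theta> * coef_d2 \<theta>"
    using lead by (simp_all add: B_def e21_def e22_def reverse_fps_def numeral_eq_Suc add_ac)
qed

text \<open>The matrix in the global frame is the local matrix at \<open>x\<close> times unit
  matrices on both sides, so its determinant inherits the zero.\<close>

lemma frame_det_zero:
  assumes X: "is_dconn X" "zeros_poles_of_type \<theta> X" and S: "bundle_iso S (O_sum 0 (-1)) (fst X)"
    and A: "gauge S (snd X) = map_mat to_fract (mat2 a11 a12 a21 a22)" and x: "x \<in> set (zeros \<theta>)"
  shows "poly (a11 * a22 - a12 * a21) x = 0"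
proof -
  define N where "N = (\<lambda>x. matrix_inv (fst X x) ** S ** O_sum 0 (-1) x)"
  have N: "unit_mat_at x (N x)" and Si: "invertible S" for x using S by (auto simp: N_def
      bundle_iso_def)
  have "local_mat (O_sum 0 (-1), gauge S (snd X)) (Fin x) = gauge S (snd X)"
    by (simp add: local_mat_alt shift.map_mat_one del: mat_mult_2)
  then have "local_mat X (Fin x) ** N (Fin x) = map_mat shift (N (Fin (x + 1))) ** gauge S (snd X)"
    using local_mat_frame[of X "O_sum 0 (-1)" S "Fin x"] X Si
    by (simp add: N_def is_dconn_def is_bundle_def O_sum_invertible)
  moreover have M: "unit_mat_at (Fin x) (map_mat shift (N (Fin (x + 1))))"
    using unit_mat_at_shift[of "Fin x"] N by simp
  ultimately have G: "gauge S (snd X) =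
      matrix_inv (map_mat shift (N (Fin (x + 1)))) ** (local_mat X (Fin x) ** N (Fin x))"
    by (simp add: matrix_inv_cancel unit_mat_at_def)
  have "vanishes_at x (det (local_mat X (Fin x)))"
    using X(2) x by (auto simp: zeros_poles_of_type_def intro: simple_zero_vanishes)
  then have "vanishes_at x (det (N (Fin x)) *
      (det (matrix_inv (map_mat shift (N (Fin (x + 1))))) * det (local_mat X (Fin x))))"
    using N[of "Fin x"] M unfolding unit_mat_at_def by (blast intro: vanishes_at_mult
        regular_at_det)
  moreover have "det (gauge S (snd X)) = det (N (Fin x)) *
      (det (matrix_inv (map_mat shift (N (Fin (x + 1))))) * det (local_mat X (Fin x)))"
    unfolding G det_mul by (simp only: mult_ac)
  moreover have "det (gauge S (snd X)) = to_fract (a11 * a22 - a12 * a21)" by (simp add: A det_2)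
  ultimately have "vanishes_at x (to_fract (a11 * a22 - a12 * a21))" by metis
  then show ?thesis by (simp only: vanishes_at_to_fract)
qed

text \<open>\<open>matrix_inv S' ** S\<close> is the identity of the generic fibre, read as a map
  from the old bundle to the new one. It is regular at finite points because the stalks only grow;
  at \<open>a\<close> and \<open>b\<close> it is the local matrix of \<open>A\<close> up to units,
  so its determinant vanishes there.\<close>

lemma modification_matrix:
  assumes X: "is_dconn X" "zeros_poles_of_type \<theta> X" "a \<in> set (zeros \<theta>)" "b \<in> set (zeros \<theta>)"
    and S: "bundle_iso S (O_sum 0 (-1)) (fst X)"
    and S': "bundle_iso S' (O_sum 0 (-1)) (fst (modified a b X))"
  obtains r11 r12 r21 r22 where "matrix_inv S' ** S = map_mat to_fract (mat2 r11 r12 r21 r22)"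
    "degree r11 \<le> 1" "degree r12 \<le> 2" "degree r21 = 0" "degree r22 \<le> 1"
    "r11 * r22 - r12 * r21 \<noteq> 0"
    "poly (r11 * r22 - r12 * r21) a = 0" "poly (r11 * r22 - r12 * r21) b = 0"
proof -
  let ?L = "fst X" and ?L' = "fst (modified a b X)" and ?O = "O_sum 0 (-1)"
  define R where "R = matrix_inv S' ** S"
  define N where "N = (\<lambda>x. matrix_inv (?L x) ** S ** ?O x)"
  define N' where "N' = (\<lambda>x. matrix_inv (?L' x) ** S' ** ?O x)"
  have N: "unit_mat_at x (N x)" and N': "unit_mat_at x (N' x)" for x
    using S S' by (auto simp: N_def N'_def bundle_iso_def)
  have inv: "invertible S" "invertible S'" using S S' by (auto simp: bundle_iso_def)
  have L: "invertible (?L x)" "invertible (snd X)" for x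
    using X by (auto simp: is_dconn_def is_bundle_def)
  have L': "invertible (?L' x)" for x
    unfolding modified_def using L
    by (auto intro!: invertible_mult invertible_matrix_inv shift.invertible simp: invertible_mat
        simp del: mat_mult_2)
  have R: "R = ?O x ** (matrix_inv (N' x) ** (matrix_inv (?L' x) ** ?L x) ** N x) ** matrix_inv
      (?O x)" for x
    unfolding R_def N_def N'_def
    by (simp add: matrix_inv_mult invertible_mult invertible_matrix_inv matrix_inv_matrix_inv
        matrix_inv_cancel
        matrix_inv_mult_right O_sum_invertible L L' inv del: mat_mult_2 flip: matrix_mul_assoc)
  have R_Fin: "R = matrix_inv (N' (Fin x)) ** (matrix_inv (?L' (Fin x)) ** ?L (Fin x)) ** N (Fin
      x)" for x
    using R[of "Fin x"] by (simp del: mat_mult_2)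
  have at: "R = matrix_inv (N' (Fin x)) ** local_mat X (Fin x) ** N (Fin x)" if "x \<in> {a, b}" for x
  proof -
    have "?L' (Fin x) = matrix_inv (snd X) ** map_mat shift (?L (Fin (x + 1)))"
      using that by (auto simp: modified_def)
    then have "matrix_inv (?L' (Fin x)) ** ?L (Fin x) = local_mat X (Fin x)"
      by (simp add: local_mat_alt matrix_inv_mult matrix_inv_matrix_inv L shift.invertible
          invertible_matrix_inv matrix_mul_assoc)
    then show ?thesis using R_Fin[of x] by simp
  qed
  have reg: "regular_mat_at (Fin x) R" for x
  proof (cases "x \<in> {a, b}")
    case True
    then have "regular_mat_at (Fin x) (local_mat X (Fin x))"
      using X by (auto simp: zeros_poles_of_type_def)
    then show ?thesis
      unfolding at[OF True] using N[of "Fin x"] N'[of "Fin x"]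
      by (intro regular_mat_at_mult) (auto simp: unit_mat_at_def)
  next
    case False
    then have "?L' (Fin x) = ?L (Fin x)" by (auto simp: modified_def)
    then have "R = matrix_inv (N' (Fin x)) ** N (Fin x)"
      using R_Fin[of x] by (simp add: matrix_inv_mult_left L del: mat_mult_2)
    then show ?thesis
      using N[of "Fin x"] N'[of "Fin x"] by (auto simp: unit_mat_at_def intro: regular_mat_at_mult)
  qed
  have "\<exists>f. R $ i $ j = to_fract f" for i j
    using polynomial_if_regular[of "R $ i $ j"] reg unfolding regular_mat_at_def by metis
  then obtain r11 r12 r21 r22 where r: "R $ 1 $ 1 = to_fract r11" "R $ 1 $ 2 = to_fract r12"
      "R $ 2 $ 1 = to_fract r21" "R $ 2 $ 2 = to_fract r22"
    by metis
  then have Rr: "R = map_mat to_fract (mat2 r11 r12 r21 r22)" by (simp add: mat2_eq_iff)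
  have detR: "det R = to_fract (r11 * r22 - r12 * r21)" by (simp add: Rr det_2)
  have "invertible R" unfolding R_def by (intro invertible_mult invertible_matrix_inv inv)
  then have "r11 * r22 - r12 * r21 \<noteq> 0"
    using detR by (metis invertible_det_nz to_fract_0)
  moreover have "poly (r11 * r22 - r12 * r21) x = 0" if "x \<in> {a, b}" for x
  proof -
    have "vanishes_at x (det (local_mat X (Fin x)))"
      using X that by (auto simp: zeros_poles_of_type_def intro: simple_zero_vanishes)
    then have "vanishes_at x (det (N (Fin x)) * (det (matrix_inv (N' (Fin x))) * det (local_mat X
        (Fin x))))"
      using N[of "Fin x"] N'[of "Fin x"] unfolding unit_mat_at_def
      by (blast intro: vanishes_at_mult regular_at_det)
    moreover have "det R = det (N (Fin x)) * (det (matrix_inv (N' (Fin x))) * det (local_mat X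
        (Fin x)))"
      unfolding at[OF that] det_mul by (simp only: mult_ac)
    ultimately have "vanishes_at x (det R)" by simp
    then show ?thesis unfolding detR vanishes_at_to_fract .
  qed
  moreover have "degree r11 \<le> 1" "degree r12 \<le> 2" "degree r21 \<le> 0" "degree r22 \<le> 1"
  proof -
    define K where "K = matrix_inv (N' Infty) ** N Infty"
    have K: "regular_mat_at Infty K"
      using N[of Infty] N'[of Infty] by (auto simp: K_def unit_mat_at_def intro:
          regular_mat_at_mult)
    have "?L' Infty = ?L Infty ** mat (inverse z_fun)" by (simp add: modified_def del: mat_mult_2)
    then have Lz: "matrix_inv (?L' Infty) ** ?L Infty = mat z_fun"
      by (simp add: matrix_inv_mult invertible_mat L matrix_inv_mult_left del: mat_mult_2 flip:
          matrix_mul_assoc)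
    have "matrix_inv (N' Infty) ** (matrix_inv (?L' Infty) ** ?L Infty) ** N Infty = map_mat (\<lambda>h.
        z_fun * h) K"
      unfolding Lz by (simp add: K_def mat2_eq_iff mat2_mult_nth algebra_simps)
    \<comment> \<open>At infinity the map is z times a unit \<open>K\<close>. Conjugation by the
      frame diag(1, z^-1) turns the factor z into the degree bounds 1, 2, 0, 1.\<close>
    then have RK: "R ** ?O Infty = ?O Infty ** map_mat (\<lambda>h. z_fun * h) K"
      using R[of Infty] O_sum_invertible[of 0 "-1" Infty] by (simp add: matrix_inv_cancel)
    have "to_fract r11 = z_fun * K $ 1 $ 1" "to_fract r12 * inverse z_fun = z_fun * K $ 1 $ 2"
      "to_fract r21 = inverse z_fun * (z_fun * K $ 2 $ 1)"
      "to_fract r22 * inverse z_fun = inverse z_fun * (z_fun * K $ 2 $ 2)"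
      using RK by (simp_all add: mat2_eq_iff mat2_mult_nth r del: to_fract_eq_0_iff)
    moreover have "to_fract r12 / z_fun ^ 2 = to_fract r12 * inverse z_fun / z_fun"
      by (simp add: divide_inverse power2_eq_square mult.assoc)
    ultimately have "to_fract r11 / z_fun ^ 1 = K $ 1 $ 1" "to_fract r12 / z_fun ^ 2 = K $ 1 $ 2"
      "to_fract r21 / z_fun ^ 0 = K $ 2 $ 1" "to_fract r22 / z_fun ^ 1 = K $ 2 $ 2"
      using z_fun_nz(1) by simp_all
    then show "degree r11 \<le> 1" "degree r12 \<le> 2" "degree r21 \<le> 0" "degree r22 \<le> 1"
      using K degree_le_if_regular_Infty[of r11 1] degree_le_if_regular_Infty[of r12 2]
        degree_le_if_regular_Infty[of r21 0] degree_le_if_regular_Infty[of r22 1]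
      unfolding regular_mat_at_def by (simp_all only:)
  qed
  ultimately show thesis using that[of r11 r12 r21 r22] Rr by (simp add: R_def)
qed

text \<open>Composing a frame of \<open>X\<close> with the inverse isomorphism gives a frame of
  \<open>Y\<close> in which the matrix is literally the same.\<close>

lemma has_coordinates_iso:
  assumes "dconn_iso Y X" "is_dconn X" "is_dconn Y" "has_coordinates \<theta> X q p"
  shows "has_coordinates \<theta> Y q p"
proof -
  obtain U where U: "bundle_iso U (fst Y) (fst X)" "map_mat shift U ** snd Y = snd X ** U"
    using assms(1) by (auto simp: dconn_iso_def)
  obtain S a11 a12 a21 a22 where S: "bundle_iso S (O_sum 0 (-1)) (fst X)"
      "gauge S (snd X) = map_mat to_fract (mat2 a11 a12 a21 a22)"
    and rest: "degree a11 \<le> 3 \<and> degree a12 \<le> 3 \<and> degree a21 \<le> 1 \<and> degree a22 \<le> 3 \<and>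
        a21 \<noteq> 0 \<and> section_value 1 a21 q = 0 \<and> p = p_value \<theta> a11 a22 q"
    using assms(4) unfolding has_coordinates_def by blast
  define T where "T = matrix_inv U ** S"
  have inv: "invertible U" "invertible S" using U S by (auto simp: bundle_iso_def)
  have L: "invertible (fst X x)" "invertible (fst Y x)" for x
    using assms(2,3) by (auto simp: is_dconn_def is_bundle_def)
  have "unit_mat_at x (matrix_inv (fst Y x) ** T ** O_sum 0 (-1) x)" for x
  proof -
    have "matrix_inv (fst Y x) ** T ** O_sum 0 (-1) x =
        matrix_inv (matrix_inv (fst X x) ** U ** fst Y x) ** (matrix_inv (fst X x) ** S ** O_sum 0
            (-1) x)"
      by (simp add: T_def matrix_inv_mult invertible_mult invertible_matrix_inv
          matrix_inv_matrix_inv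
          matrix_inv_cancel L inv flip: matrix_mul_assoc)
    then show ?thesis
      using U(1) S(1) by (simp add: bundle_iso_def unit_mat_at_mult unit_mat_at_inv)
  qed
  then have "bundle_iso T (O_sum 0 (-1)) (fst Y)"
    unfolding bundle_iso_def using inv by (simp add: T_def invertible_mult invertible_matrix_inv)
  moreover have "gauge T (snd Y) = gauge S (snd X)"
  proof -
    have "snd Y = matrix_inv (map_mat shift U) ** (snd X ** U)"
      using U(2)[symmetric] inv by (simp add: matrix_inv_cancel shift.invertible)
    then show ?thesis
      using inv by (simp add: gauge_def T_def shift.map_mat_mult shift.map_matrix_inv
          matrix_inv_mult
          matrix_inv_matrix_inv invertible_matrix_inv shift.invertible matrix_inv_cancel flip:
              matrix_mul_assoc)
  qed
  ultimately show ?thesis unfolding has_coordinates_def using S(2) rest by metis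
qed

section \<open>The coordinates of the modification\<close>

abbreviation lin :: "complex \<Rightarrow> complex poly" where
  "lin x \<equiv> [:- x, 1:]"

section \<open>Polynomials of degree at most three, and partial fractions\<close>

lemma degree_le_1_pCons:
  fixes f :: "complex poly"
  assumes "degree f \<le> 1"
  shows "f = [:coeff f 0, coeff f 1:]"
proof (rule poly_eqI)
  fix n show "coeff f n = coeff [:coeff f 0, coeff f 1:] n"
    using assms by (cases n; cases "n - 1") (auto simp: coeff_eq_0)
qed

lemma degree_le_2_pCons:
  fixes f :: "complex poly"
  assumes "degree f \<le> 2"
  shows "f = [:coeff f 0, coeff f 1, coeff f 2:]"
proof (rule poly_eqI)
  fix n :: nat
  consider "n = 0" | "n = 1" | "n = 2" | k where "n = Suc (Suc (Suc k))"
    by (metis One_nat_def Suc_1 not0_implies_Suc)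
  then show "coeff f n = coeff [:coeff f 0, coeff f 1, coeff f 2:] n"
    using assms by cases (auto simp: coeff_eq_0 numeral_2_eq_2)
qed

lemma degree_le_3_pCons:
  fixes f :: "complex poly"
  assumes "degree f \<le> 3"
  shows "f = [:coeff f 0, coeff f 1, coeff f 2, coeff f 3:]"
proof (rule poly_eqI)
  fix n :: nat
  consider "n = 0" | "n = 1" | "n = 2" | "n = 3" | k where "n = Suc (Suc (Suc (Suc k)))"
    by (metis One_nat_def Suc_1 not0_implies_Suc numeral_3_eq_3)
  then show "coeff f n = coeff [:coeff f 0, coeff f 1, coeff f 2, coeff f 3:] n"
    using assms by cases (auto simp: coeff_eq_0 numeral_2_eq_2 numeral_3_eq_3)
qed

lemma quadratic_two_roots:
  fixes f :: "complex poly"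
  assumes "degree f \<le> 2" "poly f x = 0" "poly f y = 0" "x \<noteq> y"
  shows "f = smult (coeff f 2) (lin x * lin y)"
proof -
  obtain u v w where f: "f = [:u, v, w:]" by (rule that[OF degree_le_2_pCons[OF assms(1)]])
  have e: "u + v * x + w * x\<^sup>2 = 0" "u + v * y + w * y\<^sup>2 = 0"
    using assms(2,3) by (simp_all add: f algebra_simps power2_eq_square)
  have "(x - y) * (v + w * (x + y)) = 0" using e by algebra
  then have v: "v = - w * (x + y)" using assms(4) by (simp add: eq_neg_iff_add_eq_0)
  have "u = w * x * y" using e(1) unfolding v by algebra
  then show ?thesis using v by (simp add: f numeral_2_eq_2 algebra_simps)
qed

text \<open>The third root is read off from the sum of the roots. The quadratic coefficients then
  agree too, so the difference is at most linear but has two roots.\<close>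

lemma monic_cubic_two_roots:
  fixes f :: "complex poly"
  assumes "f = [:u, v, w, 1:]" "poly f x = 0" "poly f y = 0" "x \<noteq> y"
  shows "f = lin x * lin y * lin (- w - x - y)"
proof -
  let ?g = "f - lin x * lin y * lin (- w - x - y)"
  have g: "?g = [:u + x * y * (- w - x - y), v - (x * y + (x + y) * (- w - x - y)):]"
    by (simp add: assms(1) algebra_simps)
  have "poly ?g x = 0" "poly ?g y = 0"
    unfolding poly_diff poly_mult using assms(2,3) by simp_all
  moreover have "degree ?g \<le> 2" unfolding g by simp
  ultimately have "?g = smult (coeff ?g 2) (lin x * lin y)"
    using assms(4) by (intro quadratic_two_roots)
  moreover have "coeff ?g 2 = 0" unfolding g by (simp add: numeral_2_eq_2)
  ultimately have "?g = 0" by (metis smult_0_left)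
  then show ?thesis by (simp only: right_minus_eq)
qed

text \<open>Partial fractions in \<open>t\<close>: the polynomial part of a cubic over a quadratic,
  plus the residues at \<open>t1\<close> and \<open>t2\<close>.\<close>

lemma lagrange_cubic:
  fixes e1 e2 e3 t t1 t2 :: complex
  assumes "t \<noteq> t1" "t \<noteq> t2" "t1 \<noteq> t2"
  shows "(t - e1) * (t - e2) * (t - e3) / ((t - t1) * (t - t2)) =
         t + t1 + t2 - e1 - e2 - e3
         + (t1 - e1) * (t1 - e2) * (t1 - e3) / ((t1 - t2) * (t - t1))
         + (t2 - e1) * (t2 - e2) * (t2 - e3) / ((t2 - t1) * (t - t2))"
proof -
  have nz: "t - t1 \<noteq> 0" "t - t2 \<noteq> 0" "t1 - t2 \<noteq> 0" "t2 - t1 \<noteq> 0" using assms by auto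
  have "t2 - t1 = - (t1 - t2)" by simp
  then have "(t2 - e1) * (t2 - e2) * (t2 - e3) / ((t2 - t1) * (t - t2)) =
     - ((t2 - e1) * (t2 - e2) * (t2 - e3) / ((t1 - t2) * (t - t2)))"
    by (simp only: mult_minus_left divide_minus_right)
  moreover have "(t - e1) * (t - e2) * (t - e3) * (t1 - t2) =
      (t + t1 + t2 - e1 - e2 - e3) * ((t - t1) * (t - t2) * (t1 - t2))
     + (t1 - e1) * (t1 - e2) * (t1 - e3) * (t - t2)
     - (t2 - e1) * (t2 - e2) * (t2 - e3) * (t - t1)"
    by algebra
  moreover have "N / (x * y) = S + A / (z * x) + - (B / (z * y))"
    if "N * z = S * (x * y * z) + A * y - B * x" "x \<noteq> 0" "y \<noteq> 0" "z \<noteq> 0"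
    for N S A B x y z :: complex
  proof -
    have "N = S * (x * y) + A * y / z - B * x / z"
      using that by (simp add: field_simps)
    then show ?thesis using that(2-4) by (simp add: add_divide_distrib diff_divide_distrib)
  qed
  ultimately show ?thesis
    using nz by metis
qed

text \<open>Here \<open>t\<close> is the third zero of the lower right entry in the normalised frame, and \<open>f\<close>
  is the upper left one.\<close>

lemma normal_form_relations:
  fixes a1 a2 a3 a4 a5 a6 d1 d2 p q t \<beta> \<gamma> m0 :: complex and f :: "complex poly"
  defines "E \<equiv> lin a4 * lin a5 * lin a6"
    and "t1 \<equiv> 1 - a1 - a2 - d1" and "t2 \<equiv> 1 - a1 - a2 - d2"
  assumes d: "d1 \<noteq> d2" "d1 + d2 = 1 - (a1 + a2 + a3 + a4 + a5 + a6)"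
    and f: "f * lin t = [:m0, \<beta>:] * smult \<gamma> (lin q) + lin a3 * E"
    and bg: "\<beta> * \<gamma> = - (t - t1) * (t - t2)"
    and p: "p * (q - t) = q - a3" "q = a3 \<Longrightarrow> poly f q = p * poly E q"
    and p1: "p \<noteq> 1"
    and t1: "q - (p * t1 - a3) / (p - 1) \<noteq> 0"
    and t2: "q - (p * t2 - a3) / (p - 1) \<noteq> 0"
  shows "\<beta> \<noteq> 0 \<and> - m0 / \<beta> = (p - 1) * (q + 1 - a1 - a2) + p * a3
     + ((d1 + a1 + a2 + a4 - 1) * (d1 + a1 + a2 + a5 - 1) * (d1 + a1 + a2 + a6 - 1) / (d1 - d2)
          * p / (q - (p * t1 - a3) / (p - 1))
      + (d2 + a1 + a2 + a4 - 1) * (d2 + a1 + a2 + a5 - 1) * (d2 + a1 + a2 + a6 - 1) / (d2 - d1)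
          * p / (q - (p * t2 - a3) / (p - 1)))"
proof -
  \<comment> \<open>Eliminating a_3 by \<open>p(1)\<close> shows what the denominators of the
    formula are: they vanish only for p = 0 or t = t_j.\<close>
  have den: "q - (p * s - a3) / (p - 1) = p * (t - s) / (p - 1)" for s
  proof -
    have "q * (p - 1) - (p * s - a3) = p * (t - s)" using p(1) by algebra
    then show ?thesis using p1 by (simp add: field_simps)
  qed
  have p0: "p \<noteq> 0" and tt: "t \<noteq> t1" "t \<noteq> t2"
    using t1 t2 unfolding den by auto
  have bg0: "\<beta> * \<gamma> \<noteq> 0" using bg tt by simp
  then have \<beta>: "\<beta> \<noteq> 0" and \<gamma>: "\<gamma> \<noteq> 0" by auto
  define q' where "q' = - m0 / \<beta>"
  have m0: "m0 = - \<beta> * q'" using \<beta> by (simp add: q'_def)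
  \<comment> \<open>For t distinct from q this is the determinant identity \<open>f\<close>
    evaluated at t, where its left side vanishes.\<close>
  have key: "\<beta> * \<gamma> * (t - q') = (p - 1) * poly E t"
  proof (cases "t = q")
    case False
    have "poly (f * lin t) t = poly ([:m0, \<beta>:] * smult \<gamma> (lin q) + lin a3 * E) t"
      using f by simp
    then have e: "(m0 + t * \<beta>) * (\<gamma> * (t - q)) + (t - a3) * poly E t = 0"
      by simp (simp add: algebra_simps)
    have "(p - 1) * (t - q) = - (t - a3)" using p(1) by algebra
    then have "(t - q) * (\<beta> * \<gamma> * (t - q') - (p - 1) * poly E t) = 0"
      using e unfolding m0 by algebra
    then show ?thesis using False by simp
  next
    \<comment> \<open>Now \<open>p(1)\<close> forces q = t = a_3 and leaves \<open>p\<close> open,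
      so its value comes from \<open>p(2)\<close>. The identity \<open>f\<close> is divided by z -
      a_3 before it is evaluated at a_3.\<close>
    case True
    then have q: "q = a3" "t = a3" using p(1) by auto
    have "lin a3 * f = lin a3 * (smult \<gamma> [:m0, \<beta>:] + E)"
      using f unfolding q by (simp only: mult.commute[of f] distrib_left mult_smult_right
          mult_smult_left)
        (simp only: mult.commute)
    then have "f = smult \<gamma> [:m0, \<beta>:] + E"
      by (subst (asm) mult_cancel_left) auto
    then have "poly f a3 = \<gamma> * (m0 + a3 * \<beta>) + poly E a3"
      by (simp add: ring_distribs mult.left_commute)
    then have "\<gamma> * (m0 + a3 * \<beta>) + poly E a3 = p * poly E a3" using p(2) q by simp
    then show ?thesis unfolding m0 q by algebra
  qed
  have t12: "t1 \<noteq> t2" using d by (auto simp: t1_def t2_def)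
  have Et: "poly E t = (t - a4) * (t - a5) * (t - a6)"
    unfolding E_def poly_mult by simp
  have "q' = t + (p - 1) * (poly E t / ((t - t1) * (t - t2)))"
  proof -
    have "(t - t1) * (t - t2) * (q' - t) = (p - 1) * poly E t"
      using key unfolding bg by algebra
    then have "q' - t = (p - 1) * poly E t / ((t - t1) * (t - t2))"
      using tt by (subst eq_divide_eq) (simp add: mult.commute)
    then show ?thesis by (simp add: algebra_simps)
  qed
  also have "\<dots> = t + (p - 1) * (t + t1 + t2 - a4 - a5 - a6
         + (t1 - a4) * (t1 - a5) * (t1 - a6) / ((t1 - t2) * (t - t1))
         + (t2 - a4) * (t2 - a5) * (t2 - a6) / ((t2 - t1) * (t - t2)))"
    unfolding Et lagrange_cubic[OF tt t12] ..
  also have "\<dots> = t + (p - 1) * (t + t1 + t2 - a4 - a5 - a6)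
         + ((t1 - a4) * (t1 - a5) * (t1 - a6) / (t1 - t2) * ((p - 1) / (t - t1))
         + (t2 - a4) * (t2 - a5) * (t2 - a6) / (t2 - t1) * ((p - 1) / (t - t2)))"
  proof -
    have "(p - 1) * (u + v / (x * y) + w / (z * s)) =
        (p - 1) * u + (v / x * ((p - 1) / y) + w / z * ((p - 1) / s))" for u v w x y z s
      by (simp add: distrib_left mult_ac)
    then show ?thesis by (simp only: add.assoc)
  qed
  finally have q': "q' = t + (p - 1) * (t + t1 + t2 - a4 - a5 - a6)
         + ((t1 - a4) * (t1 - a5) * (t1 - a6) / (t1 - t2) * ((p - 1) / (t - t1))
         + (t2 - a4) * (t2 - a5) * (t2 - a6) / (t2 - t1) * ((p - 1) / (t - t2)))" .
  have s: "t1 + t2 = 1 - a1 - a2 + a3 + a4 + a5 + a6"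
    using d(2) unfolding t1_def t2_def by (simp add: algebra_simps)
  \<comment> \<open>\<open>s\<close> is the degree condition on the type; \<open>p(1)\<close> in the
    form p t = (p - 1) q + a_3 removes t.\<close>
  have e0: "t + (p - 1) * (t + t1 + t2 - a4 - a5 - a6) =
      (p - 1) * (q + 1 - a1 - a2) + p * a3"
    using s p(1) by algebra
  have e1: "(t1 - a4) * (t1 - a5) * (t1 - a6) / (t1 - t2) =
     (d1 + a1 + a2 + a4 - 1) * (d1 + a1 + a2 + a5 - 1) * (d1 + a1 + a2 + a6 - 1) / (d1 - d2)"
  proof -
    have "(t1 - a4) * (t1 - a5) * (t1 - a6) =
      - ((d1 + a1 + a2 + a4 - 1) * (d1 + a1 + a2 + a5 - 1) * (d1 + a1 + a2 + a6 - 1))"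
      unfolding t1_def by algebra
    moreover have "t1 - t2 = - (d1 - d2)" by (simp add: t1_def t2_def)
    ultimately show ?thesis by (simp only: minus_divide_divide)
  qed
  have e2: "(t2 - a4) * (t2 - a5) * (t2 - a6) / (t2 - t1) =
     (d2 + a1 + a2 + a4 - 1) * (d2 + a1 + a2 + a5 - 1) * (d2 + a1 + a2 + a6 - 1) / (d2 - d1)"
  proof -
    have "(t2 - a4) * (t2 - a5) * (t2 - a6) =
      - ((d2 + a1 + a2 + a4 - 1) * (d2 + a1 + a2 + a5 - 1) * (d2 + a1 + a2 + a6 - 1))"
      unfolding t2_def by algebra
    moreover have "t2 - t1 = - (d2 - d1)" by (simp add: t1_def t2_def)
    ultimately show ?thesis by (simp only: minus_divide_divide)
  qed
  have e3: "x * ((p - 1) / (t - s)) = x * p / (q - (p * s - a3) / (p - 1))" for x s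
    unfolding den using p0 by simp
  show ?thesis using \<beta> q' unfolding q'_def[symmetric] e0 e1 e2 e3 by (intro conjI)
qed

abbreviation sh :: "complex poly \<Rightarrow> complex poly" where
  "sh f \<equiv> pcompose f [:1, 1:]"

text \<open>Unipotent frame changes with upper right entry -r22/\<rho> for A and r11/\<rho> for B
  make the modification matrix antidiagonal. In that form A R-conjugation swaps the diagonal
  entries, which forces the factors (z - a_1)(z - a_2) into the second column of A.\<close>

lemma modification_normal_form:
  fixes a11 a12 a21 a22 b11 b12 b21 b22 r11 r12 r22 F :: "complex poly"
    and a1 a2 d1 d2 :: complex
  defines "t1 \<equiv> 1 - a1 - a2 - d1" and "t2 \<equiv> 1 - a1 - a2 - d2"
  assumes a11: "a11 = [:x0, x1, \<alpha>, 1:]" and a12: "a12 = [:y0, y1, y2, \<beta>:]"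
    and a21: "a21 = smult \<gamma> (lin q)" and a22: "a22 = [:w0, w1, \<delta>, 1:]"
    and b21: "b21 = [:u0, u1:]" and r22: "r22 = [:s0, s1:]"
    and detA: "a11 * a22 - a12 * a21 = lin a1 * lin a2 * F"
    and trace: "\<alpha> + \<delta> + 1 = d1 + d2" and norm: "\<alpha> * (\<delta> + 1) - \<beta> * \<gamma> = d1 * d2"
    and e11: "sh r11 * a11 + sh r12 * a21 = b11 * r11 + b12 * [:\<rho>:]"
    and e12: "sh r11 * a12 + sh r12 * a22 = b11 * r12 + b12 * r22"
    and e21: "[:\<rho>:] * a11 + sh r22 * a21 = b21 * r11 + b22 * [:\<rho>:]"
    and e22: "[:\<rho>:] * a12 + sh r22 * a22 = b21 * r12 + b22 * r22"
    and detR: "r11 * r22 - r12 * [:\<rho>:] = [:\<kappa>:] * (lin a1 * lin a2)"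
    and nz: "\<rho> \<noteq> 0" "\<kappa> \<noteq> 0"
    and a_nonres: "a1 \<noteq> a2" "a1 \<noteq> a2 + 1" "a2 \<noteq> a1 + 1"
  obtains t f \<mu> where
    "f * lin t = smult \<mu> b21 * smult \<gamma> (lin q) + F"
    "\<mu> * u1 * \<gamma> = - (t - t1) * (t - t2)" "\<mu> \<noteq> 0"
    "poly f q = poly a11 q"
    "b11 = smult (1 / \<rho>) (sh r11 * b21) + sh (lin a1 * lin a2) * lin t"
    "poly a22 q = (q - a1) * (q - a2) * (q - t)"
proof -
  define D where "D = lin a1 * lin a2"
  define P K i where "P = [:\<rho>:]" and "K = [:\<kappa>:]" and "i = [:1 / \<rho>:]"
  have iP: "i * P = 1" using nz by (simp add: i_def P_def one_pCons)
  \<comment> \<open>\<open>A11\<close>, \<open>A12\<close>, \<open>A22\<close> are entries of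
    U(z+1)^-1 A U for the unipotent U with upper right entry -l; \<open>sl\<close> is the shift of
    \<open>l\<close>.\<close>
  define l sl where "l = i * r22" and "sl = i * sh r22"
  define A11 A22 A12 where "A11 = a11 + sl * a21" and "A22 = a22 - l * a21"
    and "A12 = a12 + sl * a22 - l * a11 - l * sl * a21"
  have D0: "D \<noteq> 0" "K \<noteq> 0" using nz by (simp_all add: D_def K_def)
  have detR': "r11 * r22 - r12 * P = K * D" using detR by (simp only: P_def K_def D_def)
  have A12: "A12 = - (i * i * K) * b21 * D"
  proof -
    have 1: "P * a12 + sh r22 * a22 = b21 * r12 + b22 * r22"
      and 2: "P * a11 + sh r22 * a21 = b21 * r11 + b22 * P" using e21 e22 by (simp_all only: P_def)
    \<comment> \<open>The second row of R(z+1) A = B R is applied to the column (-r22, P), which R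
      maps to (-K D, 0); this eliminates \<open>b22\<close>.\<close>
    have "P * (P * a12 + sh r22 * a22) - r22 * (P * a11 + sh r22 * a21) = - b21 * (K * D)"
      unfolding 1 2 detR'[symmetric] by algebra
    moreover have "A12 = i * i * (P * (P * a12 + sh r22 * a22) - r22 * (P * a11 + sh r22 * a21))"
      unfolding A12_def l_def sl_def using iP by algebra
    ultimately show ?thesis by algebra
  qed
  have B11: "D * (b11 - i * sh r11 * b21) = sh D * A22"
  proof -
    have shR: "sh r11 * sh r22 - sh r12 * P = K * sh D"
      using arg_cong[OF detR', of sh] by (simp add: pcompose_mult pcompose_diff pcompose_smult
          P_def K_def)
    have 1: "sh r11 * a12 + sh r12 * a22 = b11 * r12 + b12 * r22"
      and 2: "sh r11 * a11 + sh r12 * a21 = b11 * r11 + b12 * P" using e11 e12 by (simp_all only: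
          P_def)
    \<comment> \<open>The same column, applied to the first row, eliminates
      \<open>b12\<close>.\<close>
    have "P * (sh r11 * a12 + sh r12 * a22) - r22 * (sh r11 * a11 + sh r12 * a21) = - b11 * (K * D)"
      unfolding 1 2 detR'[symmetric] by algebra
    then have *: "sh r11 * (P * a12 - r22 * a11) + (sh r12 * P) * (a22 - l * a21) = - b11 * (K * D)"
      unfolding l_def using iP by algebra
    have "sh r12 * P = sh r11 * sh r22 - K * sh D" using shR by algebra
    then have "P * (sh r11 * A12) - K * sh D * A22 = - b11 * (K * D)"
      using * unfolding A12_def A22_def l_def sl_def using iP by algebra
    then have "K * (D * (b11 - i * sh r11 * b21)) = K * (sh D * A22)"
      unfolding A12 using iP by algebra
    then show ?thesis using D0 by simp
  qed
  have A22': "A22 = [:w0 + s0 * \<gamma> * q / \<rho>, w1 - (s0 * \<gamma> - s1 * \<gamma> * q) / \<rho>, \<delta> - s1 * \<gamma> / \<rho>, 1:]"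
    by (simp add: A22_def l_def i_def a22 a21 r22 algebra_simps add_divide_distrib
        diff_divide_distrib)
  \<comment> \<open>The third zero of \<open>A22\<close>, from the sum of its zeros.\<close>
  define t where "t = - (\<delta> - s1 * \<gamma> / \<rho>) - a1 - a2"
  \<comment> \<open>Nonresonance: D(z + 1) has no zero at \<open>a1\<close> or \<open>a2\<close>, so
    in \<open>B11\<close> the zeros of D must come from \<open>A22\<close>.\<close>
  have "poly (sh D) a1 \<noteq> 0" "poly (sh D) a2 \<noteq> 0"
    unfolding D_def poly_pcompose poly_mult using a_nonres by (auto simp: add_eq_0_iff
        algebra_simps)
  moreover have "poly (sh D * A22) a1 = 0" "poly (sh D * A22) a2 = 0"
    unfolding B11[symmetric] unfolding D_def poly_mult by simp_all
  ultimately have "poly A22 a1 = 0" "poly A22 a2 = 0" by simp_all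
  then have A22D: "A22 = D * lin t"
    unfolding D_def t_def using monic_cubic_two_roots[OF A22'] a_nonres(1) by blast
  then have "D * (b11 - i * sh r11 * b21) = D * (sh D * lin t)" unfolding B11 by algebra
  then have b11: "b11 - i * sh r11 * b21 = sh D * lin t" using D0 by simp
  define \<mu> where "\<mu> = - \<kappa> / \<rho>\<^sup>2"
  have \<mu>: "[:\<mu>:] = - (i * i * K)"
    by (simp add: \<mu>_def i_def K_def power2_eq_square)
  have "A11 * A22 - A12 * a21 = a11 * a22 - a12 * a21"
    unfolding A11_def A12_def A22_def by algebra
  then have "D * (A11 * lin t) = D * ([:\<mu>:] * b21 * a21 + F)"
    unfolding A22D A12 detA \<mu> D_def[symmetric] by algebra
  then have f: "A11 * lin t = [:\<mu>:] * b21 * a21 + F" using D0 by simp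
  have "coeff A12 3 = \<mu> * u1"
    unfolding A12 \<mu>[symmetric] by (simp add: b21 D_def numeral_3_eq_3)
  \<comment> \<open>The shift replaces s0 by s0 + s1 in \<open>sl\<close>; this is the source of the
    1 next to \<open>\<delta> - \<alpha>\<close>.\<close>
  moreover have "coeff A12 3 = \<beta> + (s1 / \<rho>) * (1 + \<delta> - \<alpha>) - (s1 / \<rho>)\<^sup>2 * \<gamma>"
    by (simp add: A12_def l_def sl_def i_def a11 a12 a21 a22 r22 numeral_3_eq_3 pcompose_pCons
        power2_eq_square algebra_simps add_divide_distrib diff_divide_distrib)
  ultimately have m: "\<mu> * u1 = \<beta> + (s1 / \<rho>) * (1 + \<delta> - \<alpha>) - (s1 / \<rho>)\<^sup>2 * \<gamma>" by simp
  have t: "t = - \<delta> + (s1 / \<rho>) * \<gamma> - a1 - a2" by (simp add: t_def)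
  show thesis
  proof (rule that)
    show "A11 * lin t = smult \<mu> b21 * smult \<gamma> (lin q) + F" using f by (simp add: a21)
    show "\<mu> * u1 * \<gamma> = - (t - t1) * (t - t2)"
      using trace norm unfolding m t t1_def t2_def by algebra
    show "\<mu> \<noteq> 0" using nz by (simp add: \<mu>_def)
    show "poly A11 q = poly a11 q" by (simp add: A11_def a21)
    show "b11 = smult (1 / \<rho>) (sh r11 * b21) + sh (lin a1 * lin a2) * lin t"
      using b11 unfolding D_def i_def by (simp add: algebra_simps)
    have "poly A22 q = poly a22 q" by (simp add: A22_def a21)
    then show "poly a22 q = (q - a1) * (q - a2) * (q - t)"
      unfolding A22D D_def poly_mult by simp
  qed
qed

text \<open>At the zero \<open>x\<close> of \<open>r11\<close> the second row gives r22(x + 1)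
  a21(x) = 0 with nonzero first factor, and then the first row gives r11(x + 1) a11(x) = 0. The zero
  y - 1 of the shifted \<open>r22\<close> passes to \<open>b21\<close> in the same way.\<close>

lemma diagonal_modification:
  fixes a11 a21 b11 b21 r11 r12 r22 :: "complex poly"
  assumes e11: "sh r11 * a11 + sh r12 * a21 = b11 * r11"
    and e21: "sh r22 * a21 = b21 * r11"
    and r11: "degree r11 \<le> 1" "r11 \<noteq> 0" "poly r11 x = 0"
    and r22: "degree r22 \<le> 1" "r22 \<noteq> 0" "poly r22 y = 0"
    and xy: "x \<noteq> y + 1" "y \<noteq> x + 1"
  shows "poly a21 x = 0" "poly a11 x = 0" "poly b21 (y - 1) = 0"
proof -
  have lin: "poly r z = coeff r 1 * (z - w) \<and> coeff r 1 \<noteq> 0"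
    if r1: "degree r \<le> 1" "r \<noteq> 0" "poly r w = 0" for r :: "complex poly" and z w
  proof -
    obtain u v where r: "r = [:u, v:]" by (rule that[OF degree_le_1_pCons[OF r1(1)]])
    have "u = - v * w" using r1(3) by (simp add: r eq_neg_iff_add_eq_0 mult.commute)
    then show ?thesis using r1(2) by (auto simp: r algebra_simps)
  qed
  note l1 = lin[OF r11] and l2 = lin[OF r22]
  have nz: "poly r22 (1 + x) \<noteq> 0" "poly r11 (1 + x) \<noteq> 0" "poly r11 (y - 1) \<noteq> 0"
    using l2[of "1 + x"] l1[of "1 + x"] l1[of "y - 1"] xy
    by (metis add.commute eq_iff_diff_eq_0 mult_eq_0_iff, simp,
        metis add.commute diff_add_cancel eq_iff_diff_eq_0 mult_eq_0_iff)
  have "poly (sh r22 * a21) x = 0" unfolding e21 using r11(3) by simp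
  then show a21: "poly a21 x = 0"
    using nz by (simp add: poly_pcompose)
  have "poly (sh r11 * a11 + sh r12 * a21) x = 0" unfolding e11 using r11(3) by simp
  then show "poly a11 x = 0"
    using nz a21 by (simp add: poly_pcompose)
  have "poly (b21 * r11) (y - 1) = 0"
    unfolding e21[symmetric] using r22(3) by (simp add: poly_pcompose)
  then show "poly b21 (y - 1) = 0"
    using nz by simp
qed

lemma section_value_1_eq_0_iff:
  assumes "degree f \<le> 1" "f \<noteq> 0"
  shows "section_value 1 f x = 0 \<longleftrightarrow>
    x = (if coeff f 1 = 0 then Infty else Fin (- coeff f 0 / coeff f 1))"
proof -
  obtain u v where f: "f = [:u, v:]" by (rule that[OF degree_le_1_pCons[OF assms(1)]])
  have "u + y * v = 0 \<longleftrightarrow> y = - u / v" if "v \<noteq> 0" for y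
    unfolding eq_divide_eq add_eq_0_iff using that by simp
  then show ?thesis using assms(2) by (cases x) (auto simp: f)
qed

text \<open>The algebraic core: the a- and b-polynomials are the matrices of the same
  \<open>A\<close> in frames of the old and the new bundle, and the r-polynomials intertwine
  them.\<close>

lemma modification_coordinates:
  fixes a d c :: "nat \<Rightarrow> complex" and \<theta> \<theta>' :: dtype and q p :: complex and Q' P' :: P1
    and a11 a12 a21 a22 b11 b12 b21 b22 r11 r12 r21 r22 :: "complex poly"
  assumes theta: "\<theta> = \<lparr>zeros = [a 1, a 2, a 3, a 4, a 5, a 6],
                       rho1 = 1, rho2 = 1, coef_d1 = d 1, coef_d2 = d 2, pole_order = 3\<rparr>"
    and degree_theta: "dtype_deg \<theta> = -1"
    and nonresonant: "\<And>i j. i \<in> {1..6} \<Longrightarrow> j \<in> {1..6} \<Longrightarrow> i \<noteq> j \<Longrightarrow> a i - a j \<notin> \<int>"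
    and d_distinct: "d 1 \<noteq> d 2"
    and theta': "\<theta>' = \<lparr>zeros = [a 1 - 1, a 2 - 1, a 3, a 4, a 5, a 6],
                       rho1 = 1, rho2 = 1, coef_d1 = d 1 + 1, coef_d2 = d 2 + 1, pole_order = 3\<rparr>"
    and c: "\<And>j. j \<in> {1, 2} \<Longrightarrow>
              c j = (d j + a 1 + a 2 + a 4 - 1) * (d j + a 1 + a 2 + a 5 - 1)
                      * (d j + a 1 + a 2 + a 6 - 1) / (d j - d (3 - j))"
    and deg: "degree a11 \<le> 3" "degree a12 \<le> 3" "degree a21 \<le> 1" "degree a22 \<le> 3"
    and monic: "coeff a11 3 = 1" "coeff a22 3 = 1"
    and trace: "coeff a11 2 + coeff a22 2 + 1 = d 1 + d 2"
    and norm: "coeff a11 2 * (coeff a22 2 + 1) - coeff a12 3 * coeff a21 1 = d 1 * d 2"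
    and detA: "\<And>i. i \<in> {1..6} \<Longrightarrow> poly (a11 * a22 - a12 * a21) (a i) = 0"
    and degR: "degree r11 \<le> 1" "degree r12 \<le> 2" "degree r21 = 0" "degree r22 \<le> 1"
    and detR: "r11 * r22 - r12 * r21 \<noteq> 0"
      "poly (r11 * r22 - r12 * r21) (a 1) = 0" "poly (r11 * r22 - r12 * r21) (a 2) = 0"
    and e11: "sh r11 * a11 + sh r12 * a21 = b11 * r11 + b12 * r21"
    and e12: "sh r11 * a12 + sh r12 * a22 = b11 * r12 + b12 * r22"
    and e21: "sh r21 * a11 + sh r22 * a21 = b21 * r11 + b22 * r21"
    and e22: "sh r21 * a12 + sh r22 * a22 = b21 * r12 + b22 * r22"
    and a21: "a21 \<noteq> 0" "section_value 1 a21 (Fin q) = 0"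
    and p: "Fin p = p_value \<theta> a11 a22 (Fin q)"
    and b21: "degree b21 \<le> 1" "b21 \<noteq> 0" "section_value 1 b21 Q' = 0"
    and P': "P' = p_value \<theta>' b11 b22 Q'"
  shows "(p \<noteq> 1 \<longrightarrow>
          (\<forall>j\<in>{1, 2}. q - (p * (1 - a 1 - a 2 - d j) - a 3) / (p - 1) \<noteq> 0) \<longrightarrow>
          Q' = Fin ((p - 1) * (q + 1 - a 1 - a 2) + p * a 3
                    + (\<Sum>j\<in>{1, 2}. c j * p / (q - (p * (1 - a 1 - a 2 - d j) - a 3) / (p - 1)))))
       \<and> (\<forall>q'. Q' = Fin q' \<longrightarrow> q' \<notin> {a 4, a 5, a 6} \<longrightarrow>
          (\<exists>p'. P' = Fin p' \<and>
             p' * p = (q' - a 1 + 1) * (q' - a 2 + 1) / ((q' - a 4) * (q' - a 5) * (q' - a 6))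
                        * ((p - 1) * (q' - q) + q' - a 3)))"
proof -
  define E where "E = lin (a 4) * lin (a 5) * lin (a 6)"
  have Ez: "poly E z = (z - a 4) * (z - a 5) * (z - a 6)" for z
    unfolding E_def poly_mult by simp
  have ne: "a i \<noteq> a j" "a i \<noteq> a j + 1" if "i \<in> {1..6}" "j \<in> {1..6}" "i \<noteq> j" for i j
    using nonresonant[OF that] by (auto intro: Ints_0)
  have E123: "poly E (a k) \<noteq> 0" if "k \<in> {1, 2, 3}" for k
    using that ne(1)[of k 4] ne(1)[of k 5] ne(1)[of k 6] by (auto simp: Ez)
  have inj: "inj_on a {1..6}" by (intro inj_onI) (metis ne(1))
  have dsum: "d 1 + d 2 = 1 - (a 1 + a 2 + a 3 + a 4 + a 5 + a 6)"
    using degree_theta unfolding theta dtype_deg_def by simp algebra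
  have pv: "p_value \<theta> a11 a22 (Fin q) = (if poly a11 q = 0 \<and> poly E q = 0
      then ratio ((q - a 1) * (q - a 2) * (q - a 3)) (poly a22 q) else ratio (poly a11 q) (poly E
          q))"
    unfolding theta p_value_def Let_def E_def section_value.simps poly_mult by auto
  have pv': "P' = Fin (poly b11 q' / poly E q')" if "Q' = Fin q'" "q' \<notin> {a 4, a 5, a 6}" for q'
  proof -
    have "poly E q' \<noteq> 0" using that by (simp add: Ez)
    then show ?thesis
      unfolding P' that(1) theta' p_value_def Let_def section_value.simps by (simp add: E_def
          ratio_def)
  qed
  obtain x0 x1 \<alpha> where a11: "a11 = [:x0, x1, \<alpha>, 1:]"
    using degree_le_3_pCons[OF deg(1)] unfolding monic by (rule that)
  obtain w0 w1 \<delta> where a22: "a22 = [:w0, w1, \<delta>, 1:]"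
    using degree_le_3_pCons[OF deg(4)] unfolding monic by (rule that)
  obtain y0 y1 y2 \<beta> where a12: "a12 = [:y0, y1, y2, \<beta>:]"
    by (rule that[OF degree_le_3_pCons[OF deg(2)]])
  obtain g0 \<gamma> where a21': "a21 = [:g0, \<gamma>:]" by (rule that[OF degree_le_1_pCons[OF deg(3)]])
  obtain u0 u1 where b21': "b21 = [:u0, u1:]" by (rule that[OF degree_le_1_pCons[OF b21(1)]])
  obtain s0 s1 where r22: "r22 = [:s0, s1:]" by (rule that[OF degree_le_1_pCons[OF degR(4)]])
  obtain \<rho> where r21: "r21 = [:\<rho>:]" by (rule that[OF degree_0_id[OF degR(3), symmetric]])
  have a21q: "poly a21 q = 0" using a21(2) by simp
  have a21'': "a21 = smult \<gamma> (lin q)"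
    using a21q by (simp add: a21' eq_neg_iff_add_eq_0 mult.commute)
  have root_a21: "z = q" if "poly a21 z = 0" for z
    using that a21(1) by (auto simp: a21'')
  have tr: "\<alpha> + \<delta> + 1 = d 1 + d 2" "\<alpha> * (\<delta> + 1) - \<beta> * \<gamma> = d 1 * d 2"
    using trace norm by (simp_all add: a11 a12 a21' a22 numeral_2_eq_2 numeral_3_eq_3)
  let ?F = "lin (a 3) * E"
  have detA': "a11 * a22 - a12 * a21 = lin (a 1) * lin (a 2) * ?F" (is "?L = ?R")
  proof -
    \<comment> \<open>The degree 6 terms cancel, since \<open>a11 * a22\<close> and the right side
      are monic; a difference of degree at most 5 with six distinct roots is zero.\<close>
    have 1: "degree (?L - ?R) \<le> 5"
      by (simp add: E_def a11 a12 a21' a22)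
    have "?L - ?R = 0"
    proof (rule poly_eqI_degree[where A = "a ` {1..6}"])
      fix z assume "z \<in> a ` {1..6}"
      then obtain i where i: "i \<in> {1..6}" "z = a i" by auto
      then have "i \<in> {1, 2, 3, 4, 5, 6}" by auto
      then have "poly ?R z = 0" unfolding i(2) E_def poly_mult by auto
      then show "poly (?L - ?R) z = poly 0 z" using detA[OF i(1)] i(2) by simp
    qed (use 1 card_image[OF inj] in simp_all)
    then show ?thesis by simp
  qed
  show ?thesis
  proof (cases "\<rho> = 0")
    case True
    have r0: "r21 = 0" by (simp add: r21 True)
    have r: "r11 \<noteq> 0" "r22 \<noteq> 0" using detR(1) by (auto simp: r0)
    have nz2: "\<not> (poly r (a 1) = 0 \<and> poly r (a 2) = 0)"
      if "degree r \<le> 1" "r \<noteq> 0" for r :: "complex poly"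
    proof
      assume *: "poly r (a 1) = 0 \<and> poly r (a 2) = 0"
      have "r = 0"
        by (rule poly_eqI_degree[where A = "{a 1, a 2}"])
           (use * that ne(1)[of 1 2] in auto)
      then show False using that by simp
    qed
    \<comment> \<open>The product \<open>r11 * r22\<close> vanishes at both points, and neither
      factor can take both, so each takes one.\<close>
    obtain i j :: nat where ij: "{i, j} = {1, 2}" "i \<noteq> j" "poly r11 (a i) = 0" "poly r22 (a j) = 0"
    proof (cases "poly r11 (a 1) = 0")
      case True
      then have "poly r11 (a 2) \<noteq> 0" using nz2[OF degR(1) r(1)] by blast
      then have "poly r22 (a 2) = 0" using detR(3) by (simp add: r0)
      then show ?thesis using True that[of 1 2] by simp
    next
      case False
      then have "poly r22 (a 1) = 0" using detR(2) by (simp add: r0)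
      moreover from this have "poly r22 (a 2) \<noteq> 0" using nz2[OF degR(4) r(2)] by blast
      then have "poly r11 (a 2) = 0" using detR(3) by (simp add: r0)
      ultimately show ?thesis using that[of 2 1] by auto
    qed
    have ij': "i \<in> {1, 2}" "j \<in> {1, 2}" using ij(1) by auto
    then have ij6: "i \<in> {1..6}" "j \<in> {1..6}" by auto
    have "poly a21 (a i) = 0" "poly a11 (a i) = 0" "poly b21 (a j - 1) = 0"
      using diagonal_modification[of r11 a11 r12 a21 b11 r22 b21 "a i" "a j"]
        e11 e21 degR r ij ne[OF ij6] ne[OF ij6(2,1)] by (auto simp: r0)
    then have q: "q = a i" "poly a11 q = 0" and "section_value 1 b21 (Fin (a j - 1)) = 0"
      using root_a21 by auto
    then have Q': "Q' = Fin (a j - 1)"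
      using section_value_1_eq_0_iff[OF b21(1,2)] b21(3) by metis
    have "poly E q \<noteq> 0" unfolding q(1) using E123[of i] ij'(1) by auto
    then have p0: "p = 0" using p q(2) unfolding pv by (simp add: ratio_def)
    \<comment> \<open>For p = 0 the sum disappears and the first formula reads q' = a_1 + a_2 - 1 -
      q.\<close>
    have "a i + a j = a 1 + a 2" using ij(1,2) by (auto simp: doubleton_eq_iff)
    then have "Q' = Fin ((p - 1) * (q + 1 - a 1 - a 2) + p * a 3
        + (\<Sum>j\<in>{1, 2}. c j * p / (q - (p * (1 - a 1 - a 2 - d j) - a 3) / (p - 1))))"
      unfolding Q' p0 q by (simp add: algebra_simps)
    moreover have "\<exists>p'. P' = Fin p' \<and>
             p' * p = (q' - a 1 + 1) * (q' - a 2 + 1) / ((q' - a 4) * (q' - a 5) * (q' - a 6))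
                        * ((p - 1) * (q' - q) + q' - a 3)"
      if "Q' = Fin q'" "q' \<notin> {a 4, a 5, a 6}" for q'
    proof -
      have "(q' - a 1 + 1) * (q' - a 2 + 1) = 0" using that(1) ij'(2) unfolding Q' by auto
      then show ?thesis using pv'[OF that] p0 by simp
    qed
    ultimately show ?thesis by blast
  next
    case False
    let ?R = "r11 * r22 - r12 * r21"
    define \<kappa> where "\<kappa> = coeff ?R 2"
    have "degree (r11 * r22) \<le> 2" "degree (r12 * r21) \<le> 2"
      using degree_mult_le[of r11 r22] degree_mult_le[of r12 r21] degR by simp_all
    then have "degree ?R \<le> 2" by (rule degree_diff_le)
    then have R: "?R = smult \<kappa> (lin (a 1) * lin (a 2))"
      unfolding \<kappa>_def using detR ne(1)[of 1 2] by (intro quadratic_two_roots) auto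
    then have \<kappa>: "\<kappa> \<noteq> 0" using detR(1) by auto
    have R': "r11 * r22 - r12 * [:\<rho>:] = [:\<kappa>:] * (lin (a 1) * lin (a 2))"
      using R unfolding r21 by simp
    have sh\<rho>: "sh [:\<rho>:] = [:\<rho>:]" by (simp add: pcompose_pCons)
    have ne12: "a 1 \<noteq> a 2" "a 1 \<noteq> a 2 + 1" "a 2 \<noteq> a 1 + 1"
      using ne[of 1 2] ne(2)[of 2 1] by simp_all
    obtain t f \<mu> where
      f: "f * lin t = smult \<mu> b21 * smult \<gamma> (lin q) + ?F"
      and mu: "\<mu> * u1 * \<gamma> = - (t - (1 - a 1 - a 2 - d 1)) * (t - (1 - a 1 - a 2 - d 2))" "\<mu> \<noteq> 0"
      and fq: "poly f q = poly a11 q"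
      and b11: "b11 = smult (1 / \<rho>) (sh r11 * b21) + sh (lin (a 1) * lin (a 2)) * lin t"
      and a22q: "poly a22 q = (q - a 1) * (q - a 2) * (q - t)"
      by (rule modification_normal_form[OF a11 a12 a21'' a22 b21' r22 detA' tr
          e11[unfolded r21] e12 e21[unfolded r21 sh\<rho>] e22[unfolded r21 sh\<rho>] R' False \<kappa> ne12])
    have aq: "poly a11 q * (q - t) = (q - a 3) * poly E q"
      using arg_cong[OF f, of "\<lambda>g. poly g q"] fq by (simp add: algebra_simps)
    have pt: "p * (q - t) = q - a 3"
    proof (cases "poly a11 q = 0 \<and> poly E q = 0")
      \<comment> \<open>The extended value of \<open>p\<close> applies: finiteness of
        \<open>p\<close> makes a22(q) nonzero, and a zero of \<open>E\<close> is neither a_1 nor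
        a_2, so these factors cancel.\<close>
      case True
      then have D: "(q - a 1) * (q - a 2) \<noteq> 0" using E123[of 1] E123[of 2] by auto
      have "poly a22 q \<noteq> 0" "p = (q - a 1) * (q - a 2) * (q - a 3) / poly a22 q"
        using p True unfolding pv by (auto simp: ratio_def split: if_splits)
      then have "p * ((q - a 1) * (q - a 2) * (q - t)) = (q - a 1) * (q - a 2) * (q - a 3)"
        using a22q by (simp add: field_simps)
      then have "((q - a 1) * (q - a 2)) * (p * (q - t)) = ((q - a 1) * (q - a 2)) * (q - a 3)"
        by (simp only: mult_ac)
      then show ?thesis using D by (simp only: mult_cancel_left) simp
    next
      case False
      then have E: "poly E q \<noteq> 0" "p = poly a11 q / poly E q"
        using p unfolding pv by (auto simp: ratio_def split: if_splits)
      then have "poly E q * (p * (q - t)) = poly E q * (q - a 3)"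
        using aq by (simp add: mult.commute)
      then show ?thesis using E(1) by simp
    qed
    have p3: "poly f q = p * poly E q" if "q = a 3"
    proof -
      have "poly E q \<noteq> 0" unfolding that using E123[of 3] by simp
      then show ?thesis using p fq unfolding pv by (auto simp: ratio_def split: if_splits)
    qed
    have f': "f * lin t = [:\<mu> * u0, \<mu> * u1:] * smult \<gamma> (lin q) + lin (a 3) * (lin (a 4) * lin (a
        5) * lin (a 6))"
      using f unfolding b21' E_def by simp
    have Q1: "Q' = Fin ((p - 1) * (q + 1 - a 1 - a 2) + p * a 3
        + (\<Sum>j\<in>{1, 2}. c j * p / (q - (p * (1 - a 1 - a 2 - d j) - a 3) / (p - 1))))"
      if "p \<noteq> 1" "\<forall>j\<in>{1, 2}. q - (p * (1 - a 1 - a 2 - d j) - a 3) / (p - 1) \<noteq> 0"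
    proof -
      have 1: "q - (p * (1 - a 1 - a 2 - d 1) - a 3) / (p - 1) \<noteq> 0"
        and 2: "q - (p * (1 - a 1 - a 2 - d 2) - a 3) / (p - 1) \<noteq> 0" using that(2) by simp_all
      have c12: "c 1 = (d 1 + a 1 + a 2 + a 4 - 1) * (d 1 + a 1 + a 2 + a 5 - 1)
                      * (d 1 + a 1 + a 2 + a 6 - 1) / (d 1 - d 2)"
        "c 2 = (d 2 + a 1 + a 2 + a 4 - 1) * (d 2 + a 1 + a 2 + a 5 - 1)
                      * (d 2 + a 1 + a 2 + a 6 - 1) / (d 2 - d 1)"
        using c[of 1] c[of 2] by simp_all
      have *: "\<mu> * u1 \<noteq> 0 \<and> - (\<mu> * u0) / (\<mu> * u1) = (p - 1) * (q + 1 - a 1 - a 2) + p * a 3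
          + (c 1 * p / (q - (p * (1 - a 1 - a 2 - d 1) - a 3) / (p - 1))
            + c 2 * p / (q - (p * (1 - a 1 - a 2 - d 2) - a 3) / (p - 1)))"
        unfolding c12
        by (rule normal_form_relations[OF d_distinct dsum f' mu(1) pt p3[unfolded E_def] that(1) 1
            2])
      then have u1: "u1 \<noteq> 0" by simp
      have "Q' = Fin (- u0 / u1)"
        using section_value_1_eq_0_iff[OF b21(1,2), of Q'] b21(3) u1 by (simp add: b21')
      also have "- u0 / u1 = - (\<mu> * u0) / (\<mu> * u1)" using mu(2) by simp
      also note *[THEN conjunct2]
      finally show ?thesis by simp
    qed
    have P1: "\<exists>p'. P' = Fin p' \<and>
             p' * p = (q' - a 1 + 1) * (q' - a 2 + 1) / ((q' - a 4) * (q' - a 5) * (q' - a 6))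
                        * ((p - 1) * (q' - q) + q' - a 3)"
      if "Q' = Fin q'" "q' \<notin> {a 4, a 5, a 6}" for q'
    proof -
      have "poly b21 q' = 0" using b21(3) that(1) by simp
      \<comment> \<open>At q' the term with \<open>b21\<close> drops out; the auxiliary t that
        remains is eliminated by \<open>pt\<close>.\<close>
      then have "poly b11 q' = (q' - a 1 + 1) * (q' - a 2 + 1) * (q' - t)"
        unfolding b11 poly_add poly_mult poly_smult poly_pcompose by (simp add: algebra_simps)
      moreover have "(q' - t) * p = (p - 1) * (q' - q) + q' - a 3" using pt by algebra
      ultimately have "poly b11 q' / poly E q' * p = (q' - a 1 + 1) * (q' - a 2 + 1)
            / ((q' - a 4) * (q' - a 5) * (q' - a 6)) * ((p - 1) * (q' - q) + q' - a 3)"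
        unfolding Ez by (metis mult.assoc times_divide_eq_left)
      then show ?thesis using pv'[OF that] by blast
    qed
    from Q1 P1 show ?thesis by blast
  qed
qed

text \<open>The identities of rational functions take a pointwise form: for finite q and p, each
  holds wherever its denominators are nonzero, and finiteness of its left-hand coordinate
  (\<open>Q'\<close> in the first, \<open>P'\<close> in the second) is part of the
  conclusion.\<close>

theorem theorem6:
  fixes a d c :: "nat \<Rightarrow> complex" and \<theta> \<theta>' :: dtype
    and X X' :: dconn and q p :: complex and Q' P' :: P1
  assumes theta: "\<theta> = \<lparr>zeros = [a 1, a 2, a 3, a 4, a 5, a 6],
                       rho1 = 1, rho2 = 1, coef_d1 = d 1, coef_d2 = d 2, pole_order = 3\<rparr>"
    and degree_theta: "dtype_deg \<theta> = -1"
    and irreducible: "\<And>I j. I \<subseteq> {1..6} \<Longrightarrow> j \<in> {1, 2} \<Longrightarrow> - d j - (\<Sum>i\<in>I. a i) \<notin> \<int>"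
    and nonresonant: "\<And>i j. i \<in> {1..6} \<Longrightarrow> j \<in> {1..6} \<Longrightarrow> i \<noteq> j \<Longrightarrow> a i - a j \<notin> \<int>"
    and d_distinct: "d 1 \<noteq> d 2"
    and theta': "\<theta>' = \<lparr>zeros = [a 1 - 1, a 2 - 1, a 3, a 4, a 5, a 6],
                       rho1 = 1, rho2 = 1, coef_d1 = d 1 + 1, coef_d2 = d 2 + 1, pole_order = 3\<rparr>"
    and c: "\<And>j. j \<in> {1, 2} \<Longrightarrow>
              c j = (d j + a 1 + a 2 + a 4 - 1) * (d j + a 1 + a 2 + a 5 - 1)
                      * (d j + a 1 + a 2 + a 6 - 1) / (d j - d (3 - j))"
    and X: "X \<in> moduli \<theta>"
    and dPVI: "is_dPVI \<theta>' X X'"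
    and qp: "has_coordinates \<theta> X (Fin q) (Fin p)"
    and qp': "has_coordinates \<theta>' X' Q' P'"
  shows "(p \<noteq> 1 \<longrightarrow>
          (\<forall>j\<in>{1, 2}. q - (p * (1 - a 1 - a 2 - d j) - a 3) / (p - 1) \<noteq> 0) \<longrightarrow>
          Q' = Fin ((p - 1) * (q + 1 - a 1 - a 2) + p * a 3
                    + (\<Sum>j\<in>{1, 2}. c j * p / (q - (p * (1 - a 1 - a 2 - d j) - a 3) / (p - 1)))))
       \<and> (\<forall>q'. Q' = Fin q' \<longrightarrow> q' \<notin> {a 4, a 5, a 6} \<longrightarrow>
          (\<exists>p'. P' = Fin p' \<and>
             p' * p = (q' - a 1 + 1) * (q' - a 2 + 1) / ((q' - a 4) * (q' - a 5) * (q' - a 6))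
                        * ((p - 1) * (q' - q) + q' - a 3)))"
proof -
  let ?Y = "modified (a 1) (a 2) X"
  have X': "is_dconn X" "zeros_poles_of_type \<theta> X" "formal_type_at_inf \<theta> X"
    using X by (auto simp: moduli_def)
  have zeros: "zeros \<theta> = a 1 # a 2 # [a 3, a 4, a 5, a 6]" by (simp add: theta)
  have zeros_iff: "x \<in> set (zeros \<theta>) \<longleftrightarrow> (\<exists>i\<in>{1..6}. x = a i)" for x
  proof -
    have "{1..6} = {1, 2, 3, 4, 5, 6 :: nat}" by auto
    then show ?thesis by (auto simp: zeros)
  qed
  have nonres: "x \<noteq> y + 1" if xy: "x \<in> set (zeros \<theta>)" "y \<in> set (zeros \<theta>)" for x y
  proof
    assume eq: "x = y + 1"
    obtain i j where ij: "i \<in> {1..6}" "j \<in> {1..6}" "x = a i" "y = a j"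
      using xy unfolding zeros_iff by blast
    have "a i - a j = 1" using eq ij(3,4) by (metis add_diff_cancel_left')
    moreover from this have "i \<noteq> j" by auto
    ultimately show False using nonresonant[OF ij(1,2)] by simp
  qed
  have ab: "a 2 \<noteq> a 1 + 1" "a 1 \<noteq> a 2 + 1"
    using nonres[of "a 2" "a 1"] nonres[of "a 1" "a 2"] by (auto simp: zeros)
  have "zeros_poles_of_type \<theta>' ?Y"
    by (rule zeros_poles_modified[OF X'(1,2) zeros]) (use nonres in \<open>auto simp: theta theta'\<close>)
  moreover have "formal_type_at_inf \<theta>' ?Y"
    by (rule formal_type_modified[OF X'(1,3) ab]) (simp_all add: theta theta')
  ultimately have Y: "?Y \<in> moduli \<theta>'" using is_dconn_modified[OF X'(1) ab] by (simp add: moduli_def)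
  then have "dconn_iso ?Y X'"
    using dPVI rationally_iso_modified[of "a 1" "a 2" X] by (auto simp: is_dPVI_def)
  then have "has_coordinates \<theta>' ?Y Q' P'"
    using qp' Y dPVI by (auto simp: is_dPVI_def moduli_def intro: has_coordinates_iso)
  then obtain S' b11 b12 b21 b22 where S': "bundle_iso S' (O_sum 0 (-1)) (fst ?Y)"
      "gauge S' (snd X) = map_mat to_fract (mat2 b11 b12 b21 b22)"
    and b: "degree b21 \<le> 1" "b21 \<noteq> 0" "section_value 1 b21 Q' = 0" "P' = p_value \<theta>' b11 b22 Q'"
    unfolding has_coordinates_def snd_modified by blast
  obtain S a11 a12 a21 a22 where S: "bundle_iso S (O_sum 0 (-1)) (fst X)"
      "gauge S (snd X) = map_mat to_fract (mat2 a11 a12 a21 a22)"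
    and deg: "degree a11 \<le> 3" "degree a12 \<le> 3" "degree a21 \<le> 1" "degree a22 \<le> 3"
    and a: "a21 \<noteq> 0" "section_value 1 a21 (Fin q) = 0" "Fin p = p_value \<theta> a11 a22 (Fin q)"
    using qp unfolding has_coordinates_def by blast
  have inv: "invertible S" "invertible S'" using S(1) S'(1) by (auto simp: bundle_iso_def)
  have formal: "formal_type_at_inf \<theta> (O_sum 0 (-1), map_mat to_fract (mat2 a11 a12 a21 a22))"
    using formal_type_frame[OF X'(1) O_sum_invertible S(1) X'(3)] unfolding S(2) .
  have lead: "coeff a11 3 = 1" "coeff a22 3 = 1" "coeff a11 2 + coeff a22 2 + 1 = d 1 + d 2"
    "coeff a11 2 * (coeff a22 2 + 1) - coeff a12 3 * coeff a21 1 = d 1 * d 2"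
    using frame_leading_coefficients[OF formal _ _ _ deg] unfolding theta by simp_all
  have detA: "poly (a11 * a22 - a12 * a21) (a i) = 0" if "i \<in> {1..6}" for i
    using frame_det_zero[OF X'(1,2) S] that zeros_iff by blast
  have z12: "a 1 \<in> set (zeros \<theta>)" "a 2 \<in> set (zeros \<theta>)" by (simp_all add: zeros)
  obtain r11 r12 r21 r22 where R: "matrix_inv S' ** S = map_mat to_fract (mat2 r11 r12 r21 r22)"
    and degR: "degree r11 \<le> 1" "degree r12 \<le> 2" "degree r21 = 0" "degree r22 \<le> 1"
    and detR: "r11 * r22 - r12 * r21 \<noteq> 0"
      "poly (r11 * r22 - r12 * r21) (a 1) = 0" "poly (r11 * r22 - r12 * r21) (a 2) = 0"
    by (rule modification_matrix[OF X'(1,2) z12 S(1) S'(1)]) (rule that)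
  \<comment> \<open>Both gauged matrices come from the same \<open>A\<close>, so the change of frame
    intertwines them.\<close>
  have "map_mat shift (matrix_inv S' ** S) ** gauge S (snd X) = gauge S' (snd X) ** (matrix_inv S'
      ** S)"
    using inv by (simp add: gauge_def shift.map_mat_mult shift.map_matrix_inv matrix_inv_cancel
        shift.invertible flip: matrix_mul_assoc)
  then have "mat2 (sh r11) (sh r12) (sh r21) (sh r22) ** mat2 a11 a12 a21 a22 =
      mat2 b11 b12 b21 b22 ** mat2 r11 r12 r21 r22"
    unfolding R S(2) S'(2) by (simp add: mat2_eq_iff mat2_mult_nth shift_to_fract flip:
        to_fract_mult to_fract_add)
  then have e: "sh r11 * a11 + sh r12 * a21 = b11 * r11 + b12 * r21"
    "sh r11 * a12 + sh r12 * a22 = b11 * r12 + b12 * r22"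
    "sh r21 * a11 + sh r22 * a21 = b21 * r11 + b22 * r21"
    "sh r21 * a12 + sh r22 * a22 = b21 * r12 + b22 * r22"
    by (simp_all add: mat2_eq_iff mat2_mult_nth)
  show ?thesis
    by (rule modification_coordinates[where \<theta> = \<theta> and \<theta>' = \<theta>' and ?a11.0 = a11 and ?a12.0 = a12
          and ?a21.0 = a21 and ?a22.0 = a22 and ?b11.0 = b11 and ?b12.0 = b12 and ?b21.0 = b21
          and ?b22.0 = b22 and ?r11.0 = r11 and ?r12.0 = r12 and ?r21.0 = r21 and ?r22.0 = r22])
      (fact theta degree_theta nonresonant d_distinct theta' c deg lead detA degR detR e a b)+
qed

end
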